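(* Let $n\ge 3$, $p>1$, $a,q\in\mathbb{R}$, and assume that $a$, $p$, $q$ satisfy one of the following four conditions: (1) $a>0$, $1<p<n$, $p\ne q$ and $q\in\left(p-1,\frac{(p-1)n}{n-p}\right)$; (2) $a>0$, $p\ge n$, $p\ne q$ and $q\in(0,+\infty)$; (3) $a\ge 1$ and $1<p=q<n<p^2$; (4) $a\ge 1$ and $p=q\ge n$. Then the equation $\Delta_p v+av^q=0$ admits no positive solution on $\mathbb{R}^n$.
   Context: $\Delta_p v=\mathrm{div}(|\nabla v|^{p-2}\nabla v)$ is the $p$-Laplace operator on $\mathbb{R}^n$. A positive solution of $\Delta_pv+av^q=0$ on $\mathbb{R}^n$ is a positive function $v\in C^1(\mathbb{R}^n)$ which is $C^3$ on $\{x:|\nabla v(x)|\ne 0\}$ and satisfies the equation weakly: $\int_{\mathbb{R}^n}|\nabla v|^{p-2}\langle\nabla v,\nabla\psi\rangle=\int_{\mathbb{R}^n} av^q\psi$ for all $\psi\in W^{1,p}_0(\mathbb{R}^n)$ with compact support. *)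

theory Defs
  imports "HOL-Analysis.Analysis"
begin

definition grad :: "(real^'n \<Rightarrow> real) \<Rightarrow> real^'n \<Rightarrow> real^'n" where
  "grad f x = (\<chi> i. frechet_derivative f (at x) (axis i 1))"

lemma grad_eq:
  fixes f :: "real^'n \<Rightarrow> real"
  assumes "GDERIV f x :> D"
  shows "grad f x = D"
proof -
  have "(f has_derivative (\<lambda>h. h \<bullet> D)) (at x)"
    using assms by (simp add: gderiv_def)
  then have "frechet_derivative f (at x) = (\<lambda>h. h \<bullet> D)"
    using frechet_derivative_at by metis
  then show ?thesis
    by (simp add: grad_def vec_eq_iff inner_axis' )
qed

text \<open>The class \<open>C\<^sup>k\<close> on a set \<open>S\<close>; only meant for open \<open>S\<close>, since the derivatives
  involved are those of the ambient space.\<close>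

primrec Ck_on :: "nat \<Rightarrow> (real^'n) set \<Rightarrow> (real^'n \<Rightarrow> real) \<Rightarrow> bool" where
  "Ck_on 0 S f \<longleftrightarrow> continuous_on S f"
| "Ck_on (Suc k) S f \<longleftrightarrow>
     (\<forall>x\<in>S. f differentiable (at x)) \<and> (\<forall>i. Ck_on k S (\<lambda>x. grad f x $ i))"

definition test_function :: "(real^'n \<Rightarrow> real) \<Rightarrow> bool" where
  "test_function \<phi> \<longleftrightarrow> (\<forall>k. Ck_on k UNIV \<phi>) \<and> compact (closure {x. \<phi> x \<noteq> 0})"

definition locally_integrable :: "('a::euclidean_space \<Rightarrow> 'b::euclidean_space) \<Rightarrow> bool" where
  "locally_integrable f \<longleftrightarrow> (\<forall>K. compact K \<longrightarrow> f absolutely_integrable_on K)"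

definition in_Lp :: "real \<Rightarrow> ('a::euclidean_space \<Rightarrow> 'b::euclidean_space) \<Rightarrow> bool" where
  "in_Lp p f \<longleftrightarrow> f \<in> borel_measurable lebesgue \<and> integrable lebesgue (\<lambda>x. norm (f x) powr p)"

definition has_weak_gradient :: "(real^'n \<Rightarrow> real) \<Rightarrow> (real^'n \<Rightarrow> real^'n) \<Rightarrow> bool" where
  "has_weak_gradient f g \<longleftrightarrow>
     locally_integrable f \<and> locally_integrable g \<and>
     (\<forall>\<phi> i. test_function \<phi> \<longrightarrow>
        (\<integral>x. f x * grad \<phi> x $ i \<partial>lebesgue) = - (\<integral>x. g x $ i * \<phi> x \<partial>lebesgue))"

text \<open>Sobolev functions are handled together with a representative of their (almost everywhere
  unique) weak gradient: \<open>W1p p f g\<close> says that \<open>f \<in> W\<^sup>1\<^sup>,\<^sup>p(\<real>\<^sup>n)\<close> and \<open>\<nabla>f = g\<close>.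
  The subspace \<open>W\<^sub>0\<^sup>1\<^sup>,\<^sup>p(\<real>\<^sup>n)\<close> is the closure of the test functions in the norm
  of \<open>W\<^sup>1\<^sup>,\<^sup>p(\<real>\<^sup>n)\<close>.\<close>

definition W1p :: "real \<Rightarrow> (real^'n \<Rightarrow> real) \<Rightarrow> (real^'n \<Rightarrow> real^'n) \<Rightarrow> bool" where
  "W1p p f g \<longleftrightarrow> in_Lp p f \<and> in_Lp p g \<and> has_weak_gradient f g"

definition W1p_zero :: "real \<Rightarrow> (real^'n \<Rightarrow> real) \<Rightarrow> (real^'n \<Rightarrow> real^'n) \<Rightarrow> bool" where
  "W1p_zero p f g \<longleftrightarrow> W1p p f g \<and>
     (\<exists>\<phi> :: nat \<Rightarrow> real^'n \<Rightarrow> real. (\<forall>k. test_function (\<phi> k)) \<and>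
        (\<lambda>k. \<integral>x. \<bar>f x - \<phi> k x\<bar> powr p \<partial>lebesgue) \<longlonglongrightarrow> 0 \<and>
        (\<lambda>k. \<integral>x. norm (g x - grad (\<phi> k) x) powr p \<partial>lebesgue) \<longlonglongrightarrow> 0)"

text \<open>Compact support in the sense of almost-everywhere equivalence classes.\<close>

definition ess_compact_support :: "(real^'n \<Rightarrow> real) \<Rightarrow> bool" where
  "ess_compact_support f \<longleftrightarrow> (\<exists>K. compact K \<and> (AE x in lebesgue. x \<notin> K \<longrightarrow> f x = 0))"

text \<open>Where \<open>grad v\<close> vanishes, \<open>norm (grad v x) powr (p - 2) *\<^sub>R grad v x\<close> is \<open>0\<close> for every
  \<open>p > 1\<close>, as usual. All integrals below are finite, since \<open>v\<close> is positive and \<open>C\<^sup>1\<close> and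
  \<open>\<psi>\<close> has compact support.\<close>

definition weak_solution ::
  "real \<Rightarrow> real \<Rightarrow> real \<Rightarrow> (real^'n \<Rightarrow> real) \<Rightarrow> bool" where
  "weak_solution p a q v \<longleftrightarrow>
     (\<forall>\<psi> g. W1p_zero p \<psi> g \<longrightarrow> ess_compact_support \<psi> \<longrightarrow>
        (\<integral>x. norm (grad v x) powr (p - 2) * (grad v x \<bullet> g x) \<partial>lebesgue)
          = (\<integral>x. a * v x powr q * \<psi> x \<partial>lebesgue))"

definition positive_solution ::
  "real \<Rightarrow> real \<Rightarrow> real \<Rightarrow> (real^'n \<Rightarrow> real) \<Rightarrow> bool" where
  "positive_solution p a q v \<longleftrightarrow>
     (\<forall>x. v x > 0) \<and> Ck_on 1 UNIV v \<and> Ck_on 3 {x. grad v x \<noteq> 0} v \<and> weak_solution p a q v"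

end

theory Submission
  imports Defs
begin

text \<open>
  In the manner of Mitidieri and Pokhozhaev, a single family of test functions suffices:
  the equation is tested with \<open>\<psi> = \<phi>\<^sup>m v\<^sup>-\<^sup>s\<close>, where \<open>\<phi>\<close> is a cutoff of the
  ball of radius \<open>R\<close> and \<open>s > 0\<close>. The negative power of \<open>v\<close> produces the term
  \<open>- s \<phi>\<^sup>m v\<^sup>-\<^sup>s\<^sup>-\<^sup>1 \<bar>\<nabla>v\<bar>\<^sup>p\<close> of favourable sign on the gradient side. It absorbs the mixed term
  \<open>m \<phi>\<^sup>m\<^sup>-\<^sup>1 v\<^sup>-\<^sup>s \<bar>\<nabla>v\<bar>\<^sup>p\<^sup>-\<^sup>1 \<bar>\<nabla>\<phi>\<bar>\<close> up to a multiple of \<open>\<phi>\<^sup>m v\<^sup>p\<^sup>-\<^sup>1\<^sup>-\<^sup>s (\<bar>\<nabla>\<phi>\<bar>/\<phi>)\<^sup>p\<close>. If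
  \<open>p - 1 - s = \<theta> (q - s)\<close> with \<open>0 < \<theta> < 1\<close>, then Young's inequality bounds the latter by half of
  \<open>a \<phi>\<^sup>m v\<^sup>q\<^sup>-\<^sup>s\<close> plus a multiple of \<open>\<bar>\<nabla>\<phi>\<bar>\<^sup>\<beta>\<close>, where \<open>\<beta> = p / (1 - \<theta>)\<close>. As \<open>\<bar>\<nabla>\<phi>\<bar> \<le> 2/R\<close> on a set of
  measure at most \<open>(2R)\<^sup>n\<close>, this gives
  \<open>\<integral> \<phi>\<^sup>m v\<^sup>q\<^sup>-\<^sup>s \<le> C R\<^sup>n\<^sup>-\<^sup>\<beta>\<close> (lemma \<open>energy_estimate\<close>).

  When \<open>\<beta> > n\<close> the right-hand side tends to \<open>0\<close> as \<open>R \<rightarrow> \<infinity>\<close>, while the left-hand side stays away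
  from \<open>0\<close>: a contradiction. Suitable \<open>\<theta>\<close> and \<open>s\<close> exist as soon as \<open>q (n - p) < n (p - 1)\<close>
  (lemma \<open>exists_exponents\<close>), and each of the four conditions implies this inequality: it is
  Serrin's subcriticality when \<open>p < n\<close>, it reads \<open>n < p\<^sup>2\<close> when \<open>p = q\<close>, and it is trivial when
  \<open>p \<ge> n\<close>.

  Since \<open>v\<close> is only \<open>C\<^sup>1\<close>, so is \<open>\<psi>\<close>, and its admissibility means that it is a limit of smooth
  functions with compact support. The first half of the text proves this for every \<open>C\<^sup>1\<close> function
  with compact support (proposition \<open>W1p_zero_C1_compact_support\<close>), by mollification. The
  cutoff \<open>\<phi>\<close> is the positive part of \<open>1 - \<bar>x\<bar>\<^sup>2/R\<^sup>2\<close>, whose powers with exponent at least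
  \<open>2\<close> are \<open>C\<^sup>1\<close>.
\<close>

section \<open>Continuously differentiable functions with compact support\<close>

definition has_C1_gradient :: "(real^'n \<Rightarrow> real) \<Rightarrow> (real^'n \<Rightarrow> real^'n) \<Rightarrow> bool" where
  "has_C1_gradient f g \<longleftrightarrow> (\<forall>x. GDERIV f x :> g x) \<and> continuous_on UNIV g"

definition cube :: "real \<Rightarrow> (real^'n) set" where
  "cube r = cbox (\<chi> i. - r) (\<chi> i. r)"

lemma mem_cube: "x \<in> cube r \<longleftrightarrow> (\<forall>i. \<bar>x $ i\<bar> \<le> r)"
  by (auto simp: cube_def mem_box_cart abs_le_iff) (metis minus_le_iff)+

lemma mem_cube_add: "x \<in> cube r \<Longrightarrow> norm y \<le> s \<Longrightarrow> x + y \<in> cube (r + s)"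
  unfolding mem_cube
  by (metis (no_types, lifting) abs_triangle_ineq add_mono component_le_norm_cart order_trans vector_add_component)

lemma has_C1_gradient_continuous: "has_C1_gradient f g \<Longrightarrow> continuous_on S f"
  unfolding has_C1_gradient_def gderiv_def
  by (meson UNIV_I continuous_on_eq_continuous_within continuous_on_subset has_derivative_continuous subset_UNIV)

lemma has_C1_gradient_continuous_gradient: "has_C1_gradient f g \<Longrightarrow> continuous_on S g"
  unfolding has_C1_gradient_def using continuous_on_subset by blast

lemma integral_compact_support:
  fixes F :: "real^'n \<Rightarrow> real"
  assumes "continuous_on UNIV F" and "\<And>x. x \<notin> cube r \<Longrightarrow> F x = 0"
  shows integrable_compact_support: "integrable lebesgue F"
    and "(\<integral>x. F x \<partial>lebesgue) = integral (cube r) F"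
proof -
  have ai: "F absolutely_integrable_on cube r"
    unfolding cube_def
    by (rule absolutely_integrable_continuous) (use assms(1) continuous_on_subset in blast)
  have eq: "(\<lambda>x. indicator (cube r) x *\<^sub>R F x) = F"
    using assms(2) by (auto simp: indicator_def fun_eq_iff)
  show "integrable lebesgue F"
    using ai unfolding set_integrable_def eq .
  show "(\<integral>x. F x \<partial>lebesgue) = integral (cube r) F"
    using set_lebesgue_integral_eq_integral(2)[OF ai] unfolding set_lebesgue_integral_def eq .
qed

lemma integral_translate:
  fixes F :: "real^'n \<Rightarrow> real"
  assumes "continuous_on UNIV F"
  shows "(\<integral>x. F (c + x) \<partial>lebesgue) = (\<integral>x. F x \<partial>lebesgue)"
proof -
  have [measurable]: "F \<in> borel_measurable borel"
    using assms by (rule borel_measurable_continuous_onI)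
  have "(\<integral>x. F (c + x) \<partial>lebesgue) = (\<integral>x. F (c + x) \<partial>lborel)"
    by (simp add: integral_completion)
  also have "\<dots> = (\<integral>x. F x \<partial>distr lborel borel ((+) c))"
    by (simp add: integral_distr)
  also have "\<dots> = (\<integral>x. F x \<partial>lebesgue)"
    by (simp add: lborel_distr_plus integral_completion)
  finally show ?thesis .
qed

text \<open>The Leibniz rule for total derivatives is stated with derivatives as bounded linear maps;
  representing them by inner products turns it into a rule for gradients.\<close>

lemma leibniz_gradient:
  fixes F :: "real^'n \<Rightarrow> real^'n \<Rightarrow> real" and G :: "real^'n \<Rightarrow> real^'n \<Rightarrow> real^'n"
  assumes G: "\<And>x y. GDERIV (\<lambda>x. F x y) x :> G x y"
    and F: "\<And>x. continuous_on UNIV (F x)"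
    and cont: "continuous_on UNIV (\<lambda>(x, y). G x y)"
  shows "GDERIV (\<lambda>x. integral (cube r) (F x)) x :> integral (cube r) (G x)"
proof -
  have c: "continuous_on A (\<lambda>(x, y). G x y)" for A
    using cont continuous_on_subset by blast
  have Gx: "G x integrable_on cube r"
  proof -
    have "continuous_on (cube r) (\<lambda>y. (\<lambda>(x, y). G x y) (x, y))"
      by (rule continuous_on_compose2[OF cont]) (auto intro!: continuous_intros)
    then show ?thesis
      by (simp add: cube_def integrable_continuous)
  qed
  have i: "(\<lambda>y. blinfun_inner_left (G x y)) integrable_on cube r"
    using integrable_linear[OF Gx bounded_linear_blinfun_inner_left] by (simp add: o_def)
  have "((\<lambda>x. integral (cube r) (F x)) has_derivative
      blinfun_apply (integral (cube r) (\<lambda>y. blinfun_inner_left (G x y)))) (at x within UNIV)"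
    unfolding cube_def
  proof (rule leibniz_rule)
    show "((\<lambda>x. F x t) has_derivative blinfun_apply (blinfun_inner_left (G x t))) (at x within UNIV)" for x t
      using G[of t x] by (simp add: gderiv_def)
    show "F x integrable_on cbox (\<chi> i. - r) (\<chi> i. r)" for x
      using F[of x] by (meson continuous_on_subset integrable_continuous subset_UNIV)
    show "continuous_on (UNIV \<times> cbox (\<chi> i. - r) (\<chi> i. r)) (\<lambda>(x, t). blinfun_inner_left (G x t))"
      using c by (auto simp: split_beta intro!: continuous_intros)
  qed auto
  moreover have "integral (cube r) (\<lambda>y. blinfun_inner_left (G x y)) = blinfun_inner_left (integral (cube r) (G x))"
    using integral_linear[OF Gx bounded_linear_blinfun_inner_left] by (simp add: o_def)
  ultimately show ?thesis
    by (simp add: gderiv_def)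
qed

text \<open>The integral of \<open>f (x + t e\<^sub>i)\<close> over \<open>\<real>\<^sup>n\<close> does not depend on \<open>t\<close>. Differentiating under the
  integral sign at \<open>t = 0\<close> yields the claim, without Fubini's theorem. The cube is enlarged by \<open>1\<close> so
  that it contains the supports of all translates with \<open>\<bar>t\<bar> < 1\<close>.\<close>

lemma integral_gradient_eq_0:
  fixes f :: "real^'n \<Rightarrow> real"
  assumes fg: "has_C1_gradient f g" and supp: "\<And>x. x \<notin> cube r \<Longrightarrow> f x = 0" 
  shows "integral (cube (r + 1)) (\<lambda>x. g x $ i) = 0"
proof -
  let ?e = "axis i 1 :: real^'n"
  let ?J = "\<lambda>t. integral (cube (r + 1)) (\<lambda>x. f (t *\<^sub>R ?e + x))"
  have fc: "continuous_on UNIV f" using has_C1_gradient_continuous[OF fg] .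
  have gc: "continuous_on S g" for S using has_C1_gradient_continuous_gradient[OF fg] .
  have "(?J has_field_derivative integral (cube (r + 1)) (\<lambda>x. g (0 *\<^sub>R ?e + x) $ i)) (at 0 within UNIV)"
    unfolding cube_def
  proof (rule leibniz_rule_field_derivative)
    show "((\<lambda>t. f (t *\<^sub>R ?e + x)) has_field_derivative g (t *\<^sub>R ?e + x) $ i) (at t within UNIV)" for t x
    proof -
      have "(f has_derivative (\<lambda>h. h \<bullet> g (t *\<^sub>R ?e + x))) (at (t *\<^sub>R ?e + x))"
        using fg by (auto simp: has_C1_gradient_def gderiv_def)
      moreover have "((\<lambda>t. t *\<^sub>R ?e + x) has_derivative (\<lambda>h. h *\<^sub>R ?e)) (at t)"
        by (auto intro!: derivative_eq_intros)
      ultimately have "((\<lambda>t. f (t *\<^sub>R ?e + x)) has_derivative (\<lambda>h. (h *\<^sub>R ?e) \<bullet> g (t *\<^sub>R ?e + x))) (at t)"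
        using has_derivative_compose by blast
      then show ?thesis
        by (simp add: has_field_derivative_def inner_axis' mult.commute[of _ "g _ $ i"] ) 
    qed
    show "(\<lambda>x. f (t *\<^sub>R ?e + x)) integrable_on cbox (\<chi> i. - (r + 1)) (\<chi> i. r + 1)" for t
      by (rule integrable_continuous, rule continuous_on_compose2[OF fc]) (auto intro!: continuous_intros)
    have "continuous_on (UNIV \<times> cbox (\<chi> i. - (r + 1)) (\<chi> i. r + 1)) (\<lambda>z. g (fst z *\<^sub>R ?e + snd z))"
      by (rule continuous_on_compose2[OF gc]) (auto intro!: continuous_intros)
    then show "continuous_on (UNIV \<times> cbox (\<chi> i. - (r + 1)) (\<chi> i. r + 1)) (\<lambda>(t, x). g (t *\<^sub>R ?e + x) $ i)"
      by (auto simp: split_beta intro!: continuous_intros)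
  qed auto
  moreover have "?J t = (\<integral>x. f x \<partial>lebesgue)" if "\<bar>t\<bar> < 1" for t
  proof -
    have "f (t *\<^sub>R ?e + x) = 0" if x: "x \<notin> cube (r + 1)" for x
    proof (rule supp, rule notI)
      assume "t *\<^sub>R ?e + x \<in> cube r"
      then have "(t *\<^sub>R ?e + x) + (- t *\<^sub>R ?e) \<in> cube (r + 1)"
        by (rule mem_cube_add) (use \<open>\<bar>t\<bar> < 1\<close> in simp)
      with x show False by simp
    qed
    moreover have "continuous_on UNIV (\<lambda>x. f (t *\<^sub>R ?e + x))"
      by (rule continuous_on_compose2[OF fc]) (auto intro!: continuous_intros)
    ultimately have "?J t = (\<integral>x. f (t *\<^sub>R ?e + x) \<partial>lebesgue)"
      by (metis integral_compact_support(2))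
    then show ?thesis
      by (simp add: integral_translate[OF fc])
  qed
  then have "eventually (\<lambda>t. ?J t = (\<integral>x. f x \<partial>lebesgue)) (nhds 0)"
    unfolding eventually_nhds_metric by (intro exI[of _ 1]) (auto simp: dist_real_def)
  ultimately have "((\<lambda>t. \<integral>x. f x \<partial>lebesgue) has_field_derivative integral (cube (r + 1)) (\<lambda>x. g x $ i)) (at 0)"
    using DERIV_cong_ev by force
  then show ?thesis
    using DERIV_unique DERIV_const by blast
qed

section \<open>Smooth kernels\<close>

text \<open>The functions \<open>t\<^sup>-\<^sup>m e\<^sup>-\<^sup>1\<^sup>/\<^sup>t\<close> on the positive half-line, extended by \<open>0\<close>. With all exponents \<open>m\<close>
  taken together, the span of this family is closed under differentiation.\<close>

definition flat :: "nat \<Rightarrow> real \<Rightarrow> real" where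
  "flat m t = (if t > 0 then exp (- 1 / t) / t ^ m else 0)"

text \<open>Any single term of the exponential series bounds \<open>e\<^sup>1\<^sup>/\<^sup>t\<close> from below; the term of order \<open>m + k\<close>
  is the one that shows vanishing to order \<open>k\<close> at \<open>0\<close>.\<close>

lemma flat_le_power: "\<bar>flat m t\<bar> \<le> fact (m + k) * \<bar>t\<bar> ^ k"
proof (cases "t > 0")
  case True
  have "(1 / t) ^ (m + k) / fact (m + k) \<le> exp (1 / t)"
  proof -
    have "(\<Sum>j\<in>{m + k}. (1 / t) ^ j /\<^sub>R fact j) \<le> exp (1 / t)"
      unfolding exp_def
      by (rule sum_le_suminf) (use True summable_exp_generic[of "1 / t"] in \<open>auto simp: divide_inverse\<close>)
    then show ?thesis by (simp add: divide_inverse mult.commute)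
  qed
  then have "inverse (exp (1 / t)) \<le> inverse ((1 / t) ^ (m + k) / fact (m + k))"
    using True by (intro le_imp_inverse_le) auto
  then have "exp (- 1 / t) \<le> fact (m + k) * t ^ (m + k)"
    using True by (simp add: exp_minus power_one_over mult.commute)
  then have "exp (- 1 / t) / t ^ m \<le> fact (m + k) * t ^ k"
    using True by (simp add: power_add field_simps)
  then show ?thesis using True by (simp add: flat_def)
qed (simp add: flat_def)

lemma DERIV_flat: "(flat m has_real_derivative flat (m + 2) t - real m * flat (m + 1) t) (at t)"
proof -
  consider "t > 0" | "t < 0" | "t = 0" by linarith
  then show ?thesis
  proof cases
    case 1
    have E: "((\<lambda>t. exp (- 1 / t)) has_real_derivative exp (- 1 / t) / t^2) (at t)"
      using 1 by (auto intro!: derivative_eq_intros simp: power2_eq_square)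
    have P: "((\<lambda>t. t ^ m) has_real_derivative real m * t ^ (m - 1)) (at t)"
      by (auto intro!: derivative_eq_intros)
    have "(e / t^2 * t ^ m - e * (real m * t ^ (m - 1))) / (t ^ m * t ^ m) = e / t ^ (m + 2) - real m * (e / t ^ (m + 1))" for e
      using 1 by (cases m) (simp_all add: field_simps power2_eq_square)
    with DERIV_divide[OF E P] have "((\<lambda>t. exp (- 1 / t) / t ^ m) has_real_derivative flat (m + 2) t - real m * flat (m + 1) t) (at t)"
      using 1 by (simp add: flat_def)
    then show ?thesis
      by (rule has_field_derivative_transform_within_open[where S = "{0<..}"])
         (use 1 in \<open>auto simp: flat_def\<close>)
  next
    case 2
    have "((\<lambda>t. 0) has_real_derivative flat (m + 2) t - real m * flat (m + 1) t) (at t)"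
      using 2 by (simp add: flat_def)
    then show ?thesis
      by (rule has_field_derivative_transform_within_open[where S = "{..<0}"])
         (use 2 in \<open>auto simp: flat_def\<close>)
  next
    case 3
    have "(\<lambda>h. fact (m + 2) * \<bar>h\<bar>) \<midarrow>0\<rightarrow> fact (m + 2) * \<bar>0 :: real\<bar>"
      by (intro tendsto_intros)
    then have lim: "(\<lambda>h. fact (m + 2) * \<bar>h :: real\<bar>) \<midarrow>0\<rightarrow> 0" by simp
    have "(\<lambda>h. flat m h / h) \<midarrow>0\<rightarrow> 0"
    proof (rule Lim_null_comparison[OF _ lim])
      have "norm (flat m h / h) \<le> fact (m + 2) * \<bar>h\<bar>" if "h \<noteq> 0" for h
        using flat_le_power[of m h 2] that by (simp add: abs_divide divide_le_eq power2_eq_square mult.assoc del: power2_abs)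
      then show "\<forall>\<^sub>F h in at 0. norm (flat m h / h) \<le> fact (m + 2) * \<bar>h\<bar>"
        by (auto simp: eventually_at_filter)
    qed
    then show ?thesis
      using 3 by (simp add: DERIV_def flat_def[of _ 0])
  qed
qed

text \<open>An algebra of functions that contains radial bumps supported in the ball of radius \<open>\<surd>c\<close> and is
  closed under partial derivatives. Smoothness of its members, and of integrals against them, then
  follows by induction on the order of differentiation, without any calculus of higher derivatives.\<close>

inductive_set smooth_algebra :: "real \<Rightarrow> (real^'n \<Rightarrow> real) set" for c where
  const: "(\<lambda>x. k) \<in> smooth_algebra c"
| coordinate: "(\<lambda>x. x $ i) \<in> smooth_algebra c"
| flat: "(\<lambda>x. flat m (c - x \<bullet> x)) \<in> smooth_algebra c"
| add: "K \<in> smooth_algebra c \<Longrightarrow> L \<in> smooth_algebra c \<Longrightarrow> (\<lambda>x. K x + L x) \<in> smooth_algebra c"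
| mult: "K \<in> smooth_algebra c \<Longrightarrow> L \<in> smooth_algebra c \<Longrightarrow> (\<lambda>x. K x * L x) \<in> smooth_algebra c"

lemma smooth_algebra_gradient:
  assumes "K \<in> smooth_algebra c"
  shows "\<exists>G. (\<forall>x. GDERIV K x :> G x) \<and> (\<forall>i. (\<lambda>x. G x $ i) \<in> smooth_algebra c)"
  using assms
proof induction
  case (const k)
  show ?case
    by (rule exI[of _ "\<lambda>_. 0"]) (auto simp: GDERIV_const smooth_algebra.const)
next
  case (coordinate i)
  have "GDERIV (\<lambda>x. x $ i) x :> axis i 1" for x :: "real^'a"
    by (simp add: gderiv_def inner_axis bounded_linear_imp_has_derivative bounded_linear_vec_nth)
  then show ?case
    by (intro exI[of _ "\<lambda>_. axis i 1"]) (auto simp: axis_def smooth_algebra.const)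
next
  case (flat m)
  let ?D = "\<lambda>x :: real^'a. flat (m + 2) (c - x \<bullet> x) - real m * flat (m + 1) (c - x \<bullet> x)"
  have "GDERIV (\<lambda>x. c - x \<bullet> x) x :> (- 2) *\<^sub>R x" for x :: "real^'a"
    unfolding gderiv_def by (auto intro!: derivative_eq_intros simp: inner_commute)
  then have "GDERIV (\<lambda>x. flat m (c - x \<bullet> x)) x :> ?D x *\<^sub>R ((- 2) *\<^sub>R x)" for x :: "real^'a"
    by (rule GDERIV_DERIV_compose) (rule DERIV_flat)
  moreover have "(\<lambda>x :: real^'a. (?D x *\<^sub>R ((- 2) *\<^sub>R x)) $ i) \<in> smooth_algebra c" for i
  proof -
    have "(\<lambda>x :: real^'a. (flat (m + 2) (c - x \<bullet> x) + (- real m) * flat (m + 1) (c - x \<bullet> x)) * ((- 2) * x $ i)) \<in> smooth_algebra c"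
      by (intro smooth_algebra.intros)
    then show ?thesis by (simp add: algebra_simps)
  qed
  ultimately show ?case by (intro exI[of _ "\<lambda>x. ?D x *\<^sub>R ((- 2) *\<^sub>R x)"]) blast
next
  case (add K L)
  then obtain G H where G: "\<forall>x. GDERIV K x :> G x" "\<forall>i. (\<lambda>x. G x $ i) \<in> smooth_algebra c"
    and H: "\<forall>x. GDERIV L x :> H x" "\<forall>i. (\<lambda>x. H x $ i) \<in> smooth_algebra c" by blast
  then have "\<forall>x. GDERIV (\<lambda>x. K x + L x) x :> G x + H x"
    by (simp add: GDERIV_add)
  moreover have "\<forall>i. (\<lambda>x. (G x + H x) $ i) \<in> smooth_algebra c"
    using G H by (simp add: smooth_algebra.add)
  ultimately show ?case by (intro exI[of _ "\<lambda>x. G x + H x"] conjI)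
next
  case (mult K L)
  then obtain G H where G: "\<forall>x. GDERIV K x :> G x" "\<forall>i. (\<lambda>x. G x $ i) \<in> smooth_algebra c"
    and H: "\<forall>x. GDERIV L x :> H x" "\<forall>i. (\<lambda>x. H x $ i) \<in> smooth_algebra c" by blast
  then have "\<forall>x. GDERIV (\<lambda>x. K x * L x) x :> K x *\<^sub>R H x + L x *\<^sub>R G x"
    by (simp add: GDERIV_mult)
  moreover have "\<forall>i. (\<lambda>x. (K x *\<^sub>R H x + L x *\<^sub>R G x) $ i) \<in> smooth_algebra c"
    using G H mult.hyps by (simp add: smooth_algebra.add smooth_algebra.mult)
  ultimately show ?case by (intro exI[of _ "\<lambda>x. K x *\<^sub>R H x + L x *\<^sub>R G x"] conjI)
qed

lemma GDERIV_continuous_on: "(\<And>x. GDERIV f x :> g x) \<Longrightarrow> continuous_on S f"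
  by (meson continuous_at_imp_continuous_on gderiv_def has_derivative_continuous)

lemma smooth_algebra_continuous: "K \<in> smooth_algebra c \<Longrightarrow> continuous_on S K"
  using smooth_algebra_gradient GDERIV_continuous_on by metis

lemma smooth_algebra_gradient_continuous:
  fixes G :: "real^'n \<Rightarrow> real^'n"
  assumes "\<forall>i. (\<lambda>x. G x $ i) \<in> smooth_algebra c"
  shows "continuous_on S G"
  using assms smooth_algebra_continuous
  by (subst continuous_on_componentwise) (auto simp: Basis_vec_def inner_axis)

lemma GDERIV_shift:
  assumes "\<And>x. GDERIV f x :> g x"
  shows "GDERIV (\<lambda>x. f (x + y)) x :> g (x + y)"
proof -
  have "((\<lambda>x. x + y) has_derivative (\<lambda>h. h)) (at x)"
    by (auto intro!: derivative_eq_intros)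
  from has_derivative_compose[OF this] show ?thesis
    using assms[of "x + y"] by (simp add: gderiv_def)
qed

lemma GDERIV_reflect:
  assumes "\<And>x. GDERIV f x :> g x"
  shows "GDERIV (\<lambda>x. f (y - x)) x :> - g (y - x)"
proof -
  have "((\<lambda>x. y - x) has_derivative (\<lambda>h. - h)) (at x)"
    by (auto intro!: derivative_eq_intros)
  from has_derivative_compose[OF this] show ?thesis
    using assms[of "y - x"] by (fastforce simp: gderiv_def)
qed

lemma GDERIV_cmult: "GDERIV f x :> g \<Longrightarrow> GDERIV (\<lambda>x. k * f x) x :> k *\<^sub>R g"
  using GDERIV_mult[OF GDERIV_const[of k]] by fastforce

section \<open>Mollification\<close>

text \<open>Correlation of \<open>f\<close> with the kernel \<open>K\<close>. For the even kernels used below it is the convolution,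
  and it avoids a reflection in the change of variables. The \<open>x\<close>-dependence sits in the kernel, which
  makes the result as smooth as \<open>K\<close>; \<open>mollify_eq_average\<close> moves it to \<open>f\<close>, where it shows that
  gradients are mollified as well.\<close>

definition mollify :: "real \<Rightarrow> (real^'n \<Rightarrow> real) \<Rightarrow> (real^'n \<Rightarrow> real) \<Rightarrow> real^'n \<Rightarrow> real" where
  "mollify r f K x = integral (cube r) (\<lambda>z. f z * K (z - x))"

lemma GDERIV_mollify:
  fixes f :: "real^'n \<Rightarrow> real"
  assumes f: "continuous_on UNIV f"
    and K: "\<And>x. GDERIV K x :> G x" and G: "continuous_on UNIV G"
  shows "GDERIV (mollify r f K) x :> integral (cube r) (\<lambda>z. f z *\<^sub>R (- G (z - x)))"
  unfolding mollify_def[abs_def]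
proof (rule leibniz_gradient)
  show "GDERIV (\<lambda>x. f z * K (z - x)) x :> f z *\<^sub>R (- G (z - x))" for x z
    using K by (intro GDERIV_cmult GDERIV_reflect)
  show "continuous_on UNIV (\<lambda>z. f z * K (z - x))" for x
    by (intro continuous_on_mult f continuous_on_compose2[OF GDERIV_continuous_on[OF K]])
       (auto intro!: continuous_intros)
  have "continuous_on UNIV (\<lambda>u. f (snd u) *\<^sub>R (- G (snd u - fst u)))"
    by (intro continuous_on_scaleR continuous_on_minus continuous_on_compose2[OF f] continuous_on_compose2[OF G])
       (auto intro!: continuous_intros)
  then show "continuous_on UNIV (\<lambda>(x, z). f z *\<^sub>R (- G (z - x)))"
    by (simp add: split_beta)
qed

lemma Ck_on_mollify:
  fixes f :: "real^'n \<Rightarrow> real"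
  assumes f: "continuous_on UNIV f" and "K \<in> smooth_algebra c"
  shows "Ck_on k UNIV (mollify r f K)"
  using \<open>K \<in> smooth_algebra c\<close>
proof (induction k arbitrary: K)
  case (0 K)
  obtain G where G: "\<forall>x. GDERIV K x :> G x" "\<forall>i. (\<lambda>x. G x $ i) \<in> smooth_algebra c"
    using smooth_algebra_gradient[OF 0] by blast
  have "continuous_on UNIV G"
    using G(2) by (rule smooth_algebra_gradient_continuous)
  then have "GDERIV (mollify r f K) x :> integral (cube r) (\<lambda>z. f z *\<^sub>R (- G (z - x)))" for x
    using GDERIV_mollify[OF f] G(1) by blast
  from GDERIV_continuous_on[OF this] show ?case by simp
next
  case (Suc k K)
  obtain G where G: "\<forall>x. GDERIV K x :> G x" "\<forall>i. (\<lambda>x. G x $ i) \<in> smooth_algebra c"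
    using smooth_algebra_gradient[OF Suc.prems] by blast
  have Gc: "continuous_on S G" for S
    using G(2) by (rule smooth_algebra_gradient_continuous)
  have D: "GDERIV (mollify r f K) x :> integral (cube r) (\<lambda>z. f z *\<^sub>R (- G (z - x)))" for x
    using GDERIV_mollify[OF f _ Gc] G(1) by blast
  have "(\<lambda>x. grad (mollify r f K) x $ i) = mollify r f (\<lambda>y. (- 1) * G y $ i)" for i
  proof
    fix x
    have "(\<lambda>z. f z *\<^sub>R G (z - x)) integrable_on cube r"
      unfolding cube_def
      by (intro integrable_continuous continuous_on_scaleR continuous_on_subset[OF f]
            continuous_on_compose2[OF Gc]) (auto intro!: continuous_intros)
    then show "grad (mollify r f K) x $ i = mollify r f (\<lambda>y. (- 1) * G y $ i) x"
      using grad_eq[OF D] by (simp add: mollify_def integral_component_eq_cart[symmetric] del: integral_component_eq_cart)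
  qed
  moreover have "(\<lambda>y. (- 1) * G y $ i) \<in> smooth_algebra c" for i
    using G(2) by (intro smooth_algebra.mult smooth_algebra.const) blast
  ultimately show ?case
    using D Suc.IH by (auto simp: gderiv_def differentiable_def)
qed

lemma Ck_on_1_gradient:
  assumes "Ck_on 1 UNIV f"
  shows "has_C1_gradient f (grad f)"
  unfolding has_C1_gradient_def
proof (intro conjI allI)
  have D: "\<forall>x. f differentiable (at x)" and C: "\<And>i. continuous_on UNIV (\<lambda>x. grad f x $ i)"
    using assms by (simp_all add: One_nat_def)
  show "continuous_on UNIV (grad f)"
    using C by (subst continuous_on_componentwise) (auto simp: Basis_vec_def inner_axis)
  show "GDERIV f x :> grad f x" for x
  proof -
    have f: "(f has_derivative frechet_derivative f (at x)) (at x)"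
      using D frechet_derivative_works by blast
    then interpret bounded_linear "frechet_derivative f (at x)"
      by (rule has_derivative_bounded_linear)
    have "frechet_derivative f (at x) h = h \<bullet> grad f x" for h
    proof -
      have "frechet_derivative f (at x) h = frechet_derivative f (at x) (\<Sum>i\<in>UNIV. (h $ i) *\<^sub>R axis i 1)"
        by (metis basis_expansion scalar_mult_eq_scaleR)
      also have "\<dots> = h \<bullet> grad f x"
        by (simp add: sum scale inner_vec_def grad_def)
      finally show ?thesis .
    qed
    then have "frechet_derivative f (at x) = (\<lambda>h. h \<bullet> grad f x)" ..
    with f show ?thesis by (simp add: gderiv_def)
  qed
qed

lemma gradient_support:
  assumes f: "has_C1_gradient f g" and supp: "\<And>x. x \<notin> cube r \<Longrightarrow> f x = 0" and x: "x \<notin> cube r"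
  shows "g x = 0"
proof -
  have "((\<lambda>x. 0) has_derivative (\<lambda>h. h \<bullet> 0)) (at x)" by simp
  then have "(f has_derivative (\<lambda>h. h \<bullet> 0)) (at x)"
    by (rule has_derivative_transform_within_open[of _ _ _ _ "- cube r"])
       (use x supp in \<open>auto simp: cube_def open_Compl closed_cbox\<close>)
  then have "GDERIV f x :> 0" by (simp add: gderiv_def)
  moreover have "GDERIV f x :> g x" using f by (simp add: has_C1_gradient_def)
  ultimately show ?thesis using grad_eq by metis
qed

text \<open>Compactness gives uniform continuity on a slightly larger cube. Two points at distance less than
  \<open>1\<close> either both lie in that cube or are both outside the support.\<close>

lemma uniformly_continuous_compact_support:
  fixes u :: "real^'n \<Rightarrow> 'b::real_normed_vector"
  assumes u: "continuous_on UNIV u" and supp: "\<And>x. x \<notin> cube r \<Longrightarrow> u x = 0" and "\<delta> > 0"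
  shows "\<exists>\<epsilon>>0. \<forall>x y. norm y < \<epsilon> \<longrightarrow> norm (u (x + y) - u x) \<le> \<delta>"
proof -
  have "uniformly_continuous_on (cube (r + 1)) u"
    unfolding cube_def by (intro compact_uniformly_continuous continuous_on_subset[OF u]) auto
  then obtain d where d: "d > 0" "\<And>x y. x \<in> cube (r + 1) \<Longrightarrow> y \<in> cube (r + 1) \<Longrightarrow> dist y x < d \<Longrightarrow> dist (u y) (u x) < \<delta>"
    unfolding uniformly_continuous_on_def using \<open>\<delta> > 0\<close> by metis
  show ?thesis
  proof (intro exI[of _ "min d 1"] conjI allI impI)
    fix x y :: "real^'n" assume y: "norm y < min d 1"
    show "norm (u (x + y) - u x) \<le> \<delta>"
    proof (cases "x \<in> cube r \<or> x + y \<in> cube r")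
      case True
      have "x \<in> cube (r + 1) \<and> x + y \<in> cube (r + 1)"
      proof (cases "x \<in> cube r")
        case True
        then show ?thesis using mem_cube_add[of x r y 1] mem_cube_add[of x r 0 1] y by simp
      next
        case False
        then have "x + y \<in> cube r" using \<open>x \<in> cube r \<or> x + y \<in> cube r\<close> by blast
        then show ?thesis using mem_cube_add[of "x + y" r "- y" 1] mem_cube_add[of "x + y" r 0 1] y by simp
      qed
      then show ?thesis using d(2)[of x "x + y"] y by (simp add: dist_norm)
    qed (use supp \<open>\<delta> > 0\<close> in simp)
  qed (use d in simp)
qed

text \<open>A multiple of \<open>exp (- 1 / (\<epsilon>\<^sup>2 - \<bar>y\<bar>\<^sup>2))\<close> extended by \<open>0\<close>, the usual mollifier.\<close>

lemma exists_smooth_kernel: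
  assumes "0 < \<epsilon>" "\<epsilon> \<le> 1"
  shows "\<exists>K \<in> smooth_algebra (\<epsilon>\<^sup>2). (\<forall>y :: real^'n. 0 \<le> K y \<and> (\<epsilon> \<le> norm y \<longrightarrow> K y = 0)) \<and> integral (cube 1) K = 1"
proof -
  let ?F = "\<lambda>y :: real^'n. flat 0 (\<epsilon>\<^sup>2 - y \<bullet> y)"
  let ?I = "integral (cube 1) ?F"
  have F: "?F \<in> smooth_algebra (\<epsilon>\<^sup>2)" by (rule smooth_algebra.flat)
  have F0: "?F y \<ge> 0" for y by (simp add: flat_def)
  have "?F 0 \<noteq> 0" using assms by (simp add: flat_def)
  then have "\<exists>y\<in>cube 1. ?F y \<noteq> 0" by (intro bexI[of _ 0]) (simp_all add: mem_cube)
  then have "?I \<noteq> 0"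
    unfolding cube_def
    by (subst integral_cbox_eq_0_iff)
       (use smooth_algebra_continuous[OF F] F0 in \<open>auto simp: cube_def box_ne_empty Basis_vec_def inner_axis interval_ne_empty_cart\<close>)
  have Fs: "?F y = 0" if "\<epsilon> \<le> norm y" for y
  proof -
    have "\<epsilon>\<^sup>2 \<le> y \<bullet> y" using that assms by (simp add: dot_square_norm power_mono)
    then show ?thesis by (simp add: flat_def)
  qed
  have "?I \<ge> 0" by (intro integral_nonneg) (use F0 smooth_algebra_continuous[OF F] in \<open>auto simp: cube_def intro!: integrable_continuous\<close>)
  then have "?I > 0" using \<open>?I \<noteq> 0\<close> by simp
  have A: "(\<lambda>y. inverse ?I * ?F y) \<in> smooth_algebra (\<epsilon>\<^sup>2)"
    by (intro smooth_algebra.intros)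
  have B: "integral (cube 1) (\<lambda>y. inverse ?I * ?F y) = 1"
    using \<open>?I \<noteq> 0\<close> by (subst integral_mult_right) simp
  have C: "\<forall>y. 0 \<le> inverse ?I * ?F y \<and> (\<epsilon> \<le> norm y \<longrightarrow> inverse ?I * ?F y = 0)"
    using F0 Fs \<open>?I > 0\<close> by simp
  show ?thesis by (rule bexI[OF _ A], rule conjI, rule C, rule B)
qed

lemma mollify_eq_average:
  fixes f :: "real^'n \<Rightarrow> real"
  assumes f: "continuous_on UNIV f" and supp: "\<And>x. x \<notin> cube r \<Longrightarrow> f x = 0"
    and K: "continuous_on UNIV K" and Ks: "\<And>y. y \<notin> cube s \<Longrightarrow> K y = 0"
  shows "mollify r f K x = integral (cube s) (\<lambda>y. f (x + y) * K y)"
proof -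
  have c: "continuous_on UNIV (\<lambda>z. f z * K (z - x))"
    by (intro continuous_on_mult f continuous_on_compose2[OF K]) (auto intro!: continuous_intros)
  have "mollify r f K x = (\<integral>z. f z * K (z - x) \<partial>lebesgue)"
    unfolding mollify_def by (rule integral_compact_support(2)[symmetric]) (use c supp in auto)
  also have "\<dots> = (\<integral>y. f (x + y) * K y \<partial>lebesgue)"
    using integral_translate[OF c, of x] by simp
  also have "\<dots> = integral (cube s) (\<lambda>y. f (x + y) * K y)"
    by (rule integral_compact_support(2))
       (use Ks in \<open>auto intro!: continuous_on_mult K continuous_on_compose2[OF f] continuous_intros\<close>)
  finally show ?thesis .
qed

lemma average_close:
  fixes u K :: "real^'n \<Rightarrow> real"
  assumes u: "continuous_on UNIV u" and K: "continuous_on UNIV K" "\<And>y. 0 \<le> K y" "integral (cube s) K = 1"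
    and close: "\<And>y. K y \<noteq> 0 \<Longrightarrow> \<bar>u (x + y) - u x\<bar> \<le> \<delta>"
  shows "\<bar>integral (cube s) (\<lambda>y. u (x + y) * K y) - u x\<bar> \<le> \<delta>"
proof -
  have Ki: "K integrable_on cube s"
    unfolding cube_def by (intro integrable_continuous continuous_on_subset[OF K(1)]) simp
  have ui: "(\<lambda>y. u (x + y) * K y) integrable_on cube s"
    unfolding cube_def
    by (intro integrable_continuous continuous_on_mult continuous_on_subset[OF K(1)] continuous_on_compose2[OF u])
       (auto intro!: continuous_intros)
  have c: "(\<lambda>y. u x * K y) integrable_on cube s" "(\<lambda>y. \<delta> * K y) integrable_on cube s"
    using Ki by (simp_all add: integrable_on_mult_right)
  have "integral (cube s) (\<lambda>y. u (x + y) * K y) - u x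
      = integral (cube s) (\<lambda>y. u (x + y) * K y - u x * K y)"
    using ui c K(3) by (simp add: integral_diff)
  also have "norm \<dots> \<le> integral (cube s) (\<lambda>y. \<delta> * K y)"
  proof (rule integral_norm_bound_integral)
    show "norm (u (x + y) * K y - u x * K y) \<le> \<delta> * K y" for y
      using close[of y] K(2)[of y]
      by (cases "K y = 0") (auto simp: left_diff_distrib[symmetric] abs_mult mult_right_mono)
  qed (use ui c in \<open>auto intro: integrable_diff\<close>)
  also have "\<dots> = \<delta>" using K(3) by simp
  finally show ?thesis by simp
qed

text \<open>Mollification approximates \<open>f\<close> and its gradient at the same time because the gradient of the
  mollified function is the mollified gradient.\<close>

lemma C1_approximation:
  fixes f :: "real^'n \<Rightarrow> real"
  assumes fg: "has_C1_gradient f g" and supp: "\<And>x. x \<notin> cube r \<Longrightarrow> f x = 0" and "\<delta> > 0"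
  shows "\<exists>\<phi>. test_function \<phi> \<and> (\<forall>x. \<bar>f x - \<phi> x\<bar> \<le> \<delta> \<and> norm (g x - grad \<phi> x) \<le> \<delta>) \<and>
    (\<forall>x. x \<notin> cube (r + 1) \<longrightarrow> \<phi> x = 0)"
proof -
  have fc: "continuous_on S f" for S using has_C1_gradient_continuous[OF fg] .
  have gc: "continuous_on S g" for S using has_C1_gradient_continuous_gradient[OF fg] .
  \<comment> \<open>The gradient is compared componentwise, so each component gets an equal share of \<open>\<delta>\<close>.\<close>
  define \<eta> where "\<eta> = \<delta> / real CARD('n)"
  have "\<eta> > 0" using \<open>\<delta> > 0\<close> by (simp add: \<eta>_def)
  have g0: "g x = 0" if "x \<notin> cube r" for x using gradient_support[OF fg supp that] .
  obtain e1 where e1: "e1 > 0" "\<And>x y. norm y < e1 \<Longrightarrow> norm (f (x + y) - f x) \<le> \<delta>"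
    using uniformly_continuous_compact_support[OF fc supp \<open>\<delta> > 0\<close>] by metis
  obtain e2 where e2: "e2 > 0" "\<And>x y. norm y < e2 \<Longrightarrow> norm (g (x + y) - g x) \<le> \<eta>"
    using uniformly_continuous_compact_support[OF gc g0 \<open>\<eta> > 0\<close>] by metis
  define \<epsilon> where "\<epsilon> = min 1 (min e1 e2)"
  have \<epsilon>: "0 < \<epsilon>" "\<epsilon> \<le> 1" using e1 e2 by (auto simp: \<epsilon>_def)
  obtain K :: "real^'n \<Rightarrow> real" where K: "K \<in> smooth_algebra (\<epsilon>\<^sup>2)" "\<And>y. 0 \<le> K y" "\<And>y. \<epsilon> \<le> norm y \<Longrightarrow> K y = 0"
    and K1: "integral (cube 1) K = 1"
    using exists_smooth_kernel[OF \<epsilon>] by metis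
  have Kc: "continuous_on S K" for S using smooth_algebra_continuous[OF K(1)] .
  have Ks: "norm y < \<epsilon>" if "K y \<noteq> 0" for y using K(3)[of y] that by force
  have Kcube: "K y = 0" if "y \<notin> cube 1" for y
  proof (rule ccontr)
    assume "K y \<noteq> 0"
    then have "norm y \<le> 1" using Ks \<epsilon> by force
    then have "0 + y \<in> cube (0 + 1)" by (intro mem_cube_add) (simp add: mem_cube)
    with that show False by simp
  qed
  define \<phi> where "\<phi> = mollify r f K"
  have \<phi>: "\<phi> x = integral (cube 1) (\<lambda>y. f (x + y) * K y)" for x
    unfolding \<phi>_def by (rule mollify_eq_average) (use fc supp Kc Kcube in auto)
  have D: "GDERIV \<phi> x :> integral (cube 1) (\<lambda>y. K y *\<^sub>R g (x + y))" for x
    unfolding \<phi>[abs_def]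
  proof (rule leibniz_gradient)
    show "GDERIV (\<lambda>x. f (x + y) * K y) x :> K y *\<^sub>R g (x + y)" for x y
      using GDERIV_cmult[OF GDERIV_shift[of f g y x], of "K y"] fg by (simp add: has_C1_gradient_def mult.commute)
    show "continuous_on UNIV (\<lambda>y. f (x + y) * K y)" for x
      by (intro continuous_on_mult Kc continuous_on_compose2[OF fc[of UNIV]]) (auto intro!: continuous_intros)
    have "continuous_on UNIV (\<lambda>z. K (snd z) *\<^sub>R g (fst z + snd z))"
      by (intro continuous_on_scaleR continuous_on_compose2[OF Kc[of UNIV]] continuous_on_compose2[OF gc[of UNIV]])
         (auto intro!: continuous_intros)
    then show "continuous_on UNIV (\<lambda>(x, y). K y *\<^sub>R g (x + y))" by (simp add: split_beta)
  qed
  have gcomp: "grad \<phi> x $ i = integral (cube 1) (\<lambda>y. g (x + y) $ i * K y)" for x i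
  proof -
    have "(\<lambda>y. K y *\<^sub>R g (x + y)) integrable_on cube 1"
      unfolding cube_def
      by (intro integrable_continuous continuous_on_scaleR Kc continuous_on_compose2[OF gc[of UNIV]])
         (auto intro!: continuous_intros)
    then show ?thesis
      using grad_eq[OF D]
      by (simp add: integral_component_eq_cart[symmetric] mult.commute del: integral_component_eq_cart)
  qed
  have A: "\<bar>\<phi> x - f x\<bar> \<le> \<delta>" for x
    unfolding \<phi>
    by (rule average_close) (use fc Kc K(2) K1 e1 Ks in \<open>auto simp: \<epsilon>_def\<close>)
  have B: "\<bar>grad \<phi> x $ i - g x $ i\<bar> \<le> \<eta>" for x i
    unfolding gcomp
  proof (rule average_close)
    show "continuous_on UNIV (\<lambda>x. g x $ i)" using gc by (auto intro!: continuous_intros)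
    fix y assume "K y \<noteq> 0"
    then have "norm (g (x + y) - g x) \<le> \<eta>" using e2 Ks by (auto simp: \<epsilon>_def)
    then show "\<bar>g (x + y) $ i - g x $ i\<bar> \<le> \<eta>"
      using component_le_norm_cart[of "g (x + y) - g x" i] by simp
  qed (use Kc K(2) K1 in auto)
  have "norm (g x - grad \<phi> x) \<le> \<delta>" for x
  proof -
    have "norm (g x - grad \<phi> x) \<le> (\<Sum>i\<in>UNIV. \<bar>(g x - grad \<phi> x) $ i\<bar>)" by (rule norm_le_l1_cart)
    also have "\<dots> \<le> (\<Sum>i\<in>(UNIV :: 'n set). \<eta>)" using B by (intro sum_mono) (simp add: abs_minus_commute)
    also have "\<dots> = \<delta>" by (simp add: \<eta>_def)
    finally show ?thesis .
  qed
  moreover have zero: "\<phi> x = 0" if "x \<notin> cube (r + 1)" for x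
  proof -
    have "f (x + y) * K y = 0" for y
    proof (rule ccontr)
      assume "f (x + y) * K y \<noteq> 0"
      then have "x + y \<in> cube r" "norm y < \<epsilon>" using supp Ks by auto
      then have "x + y + (- y) \<in> cube (r + 1)" using \<epsilon> by (intro mem_cube_add) auto
      with that show False by simp
    qed
    then show ?thesis unfolding \<phi> by (simp only: integral_0)
  qed
  moreover have "test_function \<phi>"
    unfolding test_function_def
  proof (intro conjI allI)
    show "Ck_on k UNIV \<phi>" for k
      unfolding \<phi>_def using Ck_on_mollify[OF fc K(1)] .
    have "{x. \<phi> x \<noteq> 0} \<subseteq> cube (r + 1)" using zero by blast
    then have "bounded {x. \<phi> x \<noteq> 0}" unfolding cube_def using bounded_subset[OF bounded_cbox] by blast
    then show "compact (closure {x. \<phi> x \<noteq> 0})" by simp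
  qed
  ultimately show ?thesis using A by (metis abs_minus_commute)
qed

section \<open>Sobolev functions of class \<open>C\<^sup>1\<close>\<close>


lemma in_Lp_compact_support:
  fixes u :: "real^'n \<Rightarrow> 'b::euclidean_space"
  assumes u: "continuous_on UNIV u" and supp: "\<And>x. x \<notin> cube r \<Longrightarrow> u x = 0" and "p > 0"
  shows "in_Lp p u"
  unfolding in_Lp_def
proof
  show "u \<in> borel_measurable lebesgue"
    using u by (intro measurable_completion) (simp add: borel_measurable_continuous_onI)
  have "continuous_on UNIV (\<lambda>x. norm (u x) powr p)"
    using u \<open>p > 0\<close> by (intro continuous_on_powr' continuous_intros) auto
  then show "integrable lebesgue (\<lambda>x. norm (u x) powr p)"
    by (rule integrable_compact_support) (use supp in auto)
qed

lemma locally_integrable_continuous: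
  fixes u :: "'a::euclidean_space \<Rightarrow> 'b::euclidean_space"
  assumes "continuous_on UNIV u"
  shows "locally_integrable u"
  unfolding locally_integrable_def set_integrable_def
proof (intro allI impI)
  fix K :: "'a set" assume "compact K"
  then have "integrable lborel (\<lambda>x. indicator K x *\<^sub>R u x)"
    using assms by (intro borel_integrable_compact continuous_on_subset[OF assms]) auto
  then show "integrable lebesgue (\<lambda>x. indicator K x *\<^sub>R u x)"
    by (simp add: integrable_completion borel_measurable_integrable)
qed

text \<open>Integration by parts: the product of \<open>f\<close> with a test function is \<open>C\<^sup>1\<close> with compact support, so
  the integrals of its partial derivatives vanish.\<close>

lemma has_weak_gradient_C1:
  fixes f :: "real^'n \<Rightarrow> real"
  assumes fg: "has_C1_gradient f g" and supp: "\<And>x. x \<notin> cube r \<Longrightarrow> f x = 0"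
  shows "has_weak_gradient f g"
  unfolding has_weak_gradient_def
proof (intro conjI allI impI)
  have fc: "continuous_on S f" for S using has_C1_gradient_continuous[OF fg] .
  have gc: "continuous_on S g" for S using has_C1_gradient_continuous_gradient[OF fg] .
  show "locally_integrable f" "locally_integrable g"
    using locally_integrable_continuous fc gc by blast+
  fix \<phi> :: "real^'n \<Rightarrow> real" and i assume "test_function \<phi>"
  then have \<phi>: "has_C1_gradient \<phi> (grad \<phi>)"
    by (intro Ck_on_1_gradient) (auto simp: test_function_def)
  have \<phi>c: "continuous_on S \<phi>" "continuous_on S (grad \<phi>)" for S
    using \<phi> has_C1_gradient_continuous has_C1_gradient_continuous_gradient by blast+
  have g0: "g x = 0" if "x \<notin> cube r" for x using gradient_support[OF fg supp that] .
  have mono: "x \<notin> cube r" if "x \<notin> cube (r + 1)" for x :: "real^'n"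
    using that mem_cube_add[of x r 0 1] by auto
  let ?h = "\<lambda>x. f x *\<^sub>R grad \<phi> x + \<phi> x *\<^sub>R g x"
  have "has_C1_gradient (\<lambda>x. f x * \<phi> x) ?h"
    using fg \<phi> fc gc \<phi>c unfolding has_C1_gradient_def
    by (auto intro!: GDERIV_mult continuous_intros)
  then have "integral (cube (r + 1)) (\<lambda>x. ?h x $ i) = 0"
    by (rule integral_gradient_eq_0) (simp add: supp)
  moreover have "integral (cube (r + 1)) (\<lambda>x. ?h x $ i) = (\<integral>x. ?h x $ i \<partial>lebesgue)"
    by (rule integral_compact_support(2)[symmetric])
       (use fc gc \<phi>c mono supp g0 in \<open>auto intro!: continuous_intros\<close>)
  moreover have "\<dots> = (\<integral>x. f x * grad \<phi> x $ i \<partial>lebesgue) + (\<integral>x. g x $ i * \<phi> x \<partial>lebesgue)"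
  proof (subst Bochner_Integration.integral_add[symmetric])
    show "integrable lebesgue (\<lambda>x. f x * grad \<phi> x $ i)" "integrable lebesgue (\<lambda>x. g x $ i * \<phi> x)"
      by (rule integrable_compact_support[of _ r];
          use fc gc \<phi>c supp g0 in \<open>auto intro!: continuous_intros\<close>)+
  qed (simp add: mult.commute)
  ultimately show "(\<integral>x. f x * grad \<phi> x $ i \<partial>lebesgue) = - (\<integral>x. g x $ i * \<phi> x \<partial>lebesgue)"
    by linarith
qed

lemma integral_powr_tendsto_0:
  fixes u :: "nat \<Rightarrow> real^'n \<Rightarrow> 'b::euclidean_space"
  assumes c: "\<And>k. continuous_on UNIV (u k)" and supp: "\<And>k x. x \<notin> cube r \<Longrightarrow> u k x = 0"
    and bound: "\<And>k x. norm (u k x) \<le> inverse (real (Suc k))" and "p > 0"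
  shows "(\<lambda>k. \<integral>x. norm (u k x) powr p \<partial>lebesgue) \<longlonglongrightarrow> 0"
proof (rule tendsto_sandwich)
  let ?V = "measure lebesgue (cube r :: (real^'n) set)"
  show "\<forall>\<^sub>F k in sequentially. 0 \<le> (\<integral>x. norm (u k x) powr p \<partial>lebesgue)" by simp
  show "\<forall>\<^sub>F k in sequentially. (\<integral>x. norm (u k x) powr p \<partial>lebesgue) \<le> inverse (real (Suc k)) powr p * ?V"
  proof (intro always_eventually allI)
    fix k
    have fin: "emeasure lebesgue (cube r :: (real^'n) set) < \<infinity>" "cube r \<in> sets (lebesgue :: (real^'n) measure)"
      by (simp_all add: cube_def emeasure_lborel_cbox_eq)
    have "(\<integral>x. norm (u k x) powr p \<partial>lebesgue) \<le> (\<integral>x. inverse (real (Suc k)) powr p * indicator (cube r) (x :: real^'n) \<partial>lebesgue)"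
    proof (rule Bochner_Integration.integral_mono')
      show "integrable lebesgue (\<lambda>x. inverse (real (Suc k)) powr p * indicator (cube r :: (real^'n) set) x)"
        using fin by (intro integrable_mult_right integrable_real_indicator) auto
      fix x :: "real^'n"
      show "norm (u k x) powr p \<le> inverse (real (Suc k)) powr p * indicator (cube r) x"
        using bound[of k x] supp[of x k] \<open>p > 0\<close> by (auto simp: indicator_def intro: powr_mono2)
    qed simp
    also have "\<dots> = inverse (real (Suc k)) powr p * ?V" by simp
    finally show "(\<integral>x. norm (u k x) powr p \<partial>lebesgue) \<le> inverse (real (Suc k)) powr p * ?V" .
  qed
  have "(\<lambda>k. inverse (real (Suc k)) powr p) \<longlonglongrightarrow> 0 powr p"
    using \<open>p > 0\<close> by (intro tendsto_powr' LIMSEQ_inverse_real_of_nat tendsto_const) auto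
  then show "(\<lambda>k. inverse (real (Suc k)) powr p * ?V) \<longlonglongrightarrow> 0"
    using \<open>p > 0\<close> by (auto intro: tendsto_mult_left_zero)
qed simp

proposition W1p_zero_C1_compact_support:
  fixes f :: "real^'n \<Rightarrow> real"
  assumes fg: "has_C1_gradient f g" and supp: "\<And>x. x \<notin> cube r \<Longrightarrow> f x = 0" and "p > 0"
  shows "W1p_zero p f g"
proof -
  have fc: "continuous_on UNIV f" using has_C1_gradient_continuous[OF fg] .
  have gc: "continuous_on UNIV g" using has_C1_gradient_continuous_gradient[OF fg] .
  have g0: "g x = 0" if "x \<notin> cube r" for x using gradient_support[OF fg supp that] .
  have mono: "x \<notin> cube r" if "x \<notin> cube (r + 1)" for x :: "real^'n"
    using that mem_cube_add[of x r 0 1] by auto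
  have "\<exists>\<phi>. \<forall>k. test_function (\<phi> k)
      \<and> (\<forall>x. \<bar>f x - \<phi> k x\<bar> \<le> inverse (real (Suc k)) \<and> norm (g x - grad (\<phi> k) x) \<le> inverse (real (Suc k)))
      \<and> (\<forall>x. x \<notin> cube (r + 1) \<longrightarrow> \<phi> k x = 0)"
    by (rule choice, intro allI C1_approximation[OF fg supp]) auto
  then obtain \<phi> where t: "\<And>k. test_function (\<phi> k)"
    and a: "\<And>k x. \<bar>f x - \<phi> k x\<bar> \<le> inverse (real (Suc k))"
    and b: "\<And>k x. norm (g x - grad (\<phi> k) x) \<le> inverse (real (Suc k))"
    and z: "\<And>k x. x \<notin> cube (r + 1) \<Longrightarrow> \<phi> k x = 0" by metis
  have \<phi>: "has_C1_gradient (\<phi> k) (grad (\<phi> k))" for k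
    using t by (intro Ck_on_1_gradient) (auto simp: test_function_def)
  note \<phi>c = has_C1_gradient_continuous[OF \<phi>] has_C1_gradient_continuous_gradient[OF \<phi>]
  have "(\<lambda>k. \<integral>x. norm (f x - \<phi> k x) powr p \<partial>lebesgue) \<longlonglongrightarrow> 0"
    by (rule integral_powr_tendsto_0[of _ "r + 1"])
       (use fc \<phi>c a supp mono z \<open>p > 0\<close> in \<open>auto intro!: continuous_intros\<close>)
  moreover have "(\<lambda>k. \<integral>x. norm (g x - grad (\<phi> k) x) powr p \<partial>lebesgue) \<longlonglongrightarrow> 0"
    by (rule integral_powr_tendsto_0[of _ "r + 1"])
       (use gc \<phi>c b g0 mono gradient_support[OF \<phi> z] \<open>p > 0\<close> in \<open>auto intro!: continuous_intros\<close>)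
  moreover have "in_Lp p f" "in_Lp p g"
    using in_Lp_compact_support fc gc supp g0 \<open>p > 0\<close> by blast+
  moreover have "has_weak_gradient f g" using has_weak_gradient_C1[OF fg supp] .
  ultimately show ?thesis
    unfolding W1p_zero_def W1p_def using t by (intro conjI exI[of _ \<phi>] allI) simp_all
qed

section \<open>Pointwise estimates\<close>

text \<open>The exponent \<open>\<theta>\<close> has to satisfy \<open>\<theta> > 1 - p/n\<close>, which is \<open>p / (1 - \<theta>) > n\<close>, and \<open>\<theta> q < p - 1\<close>,
  which makes the resulting \<open>s\<close> positive. The condition on \<open>q\<close> says that these two requirements are
  compatible.\<close>

lemma exists_exponents:
  fixes p q n :: real
  assumes "p > 1" "n > 0" and q: "q * (n - p) < n * (p - 1)"
  shows "\<exists>\<theta> s. 0 < \<theta> \<and> \<theta> < 1 \<and> 0 < s \<and> p - 1 - s = \<theta> * (q - s) \<and> n < p / (1 - \<theta>)"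
proof -
  define \<theta>\<^sub>0 where "\<theta>\<^sub>0 = max 0 (1 - p / n)"
  have \<theta>\<^sub>0: "\<theta>\<^sub>0 < 1" "0 \<le> \<theta>\<^sub>0" "1 - p / n \<le> \<theta>\<^sub>0"
    using assms by (auto simp: \<theta>\<^sub>0_def)
  have "\<theta>\<^sub>0 * q < p - 1"
  proof (cases "p < n")
    case True
    then show ?thesis using q \<open>n > 0\<close> by (simp add: \<theta>\<^sub>0_def max_def field_simps)
  next
    case False
    then have "\<theta>\<^sub>0 = 0" using \<open>n > 0\<close> by (simp add: \<theta>\<^sub>0_def max_def field_simps)
    then show ?thesis using \<open>p > 1\<close> by simp
  qed
  have "\<exists>\<theta>>\<theta>\<^sub>0. \<theta> < 1 \<and> \<theta> * q < p - 1"
  proof (cases "q > 0")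
    case True
    with \<open>\<theta>\<^sub>0 * q < p - 1\<close> have "\<theta>\<^sub>0 < min 1 ((p - 1) / q)" using \<theta>\<^sub>0 by (simp add: field_simps)
    then obtain \<theta> where "\<theta>\<^sub>0 < \<theta>" "\<theta> < min 1 ((p - 1) / q)" using dense by blast
    with True show ?thesis by (intro exI[of _ \<theta>]) (auto simp: field_simps)
  next
    case False
    obtain \<theta> where \<theta>: "\<theta>\<^sub>0 < \<theta>" "\<theta> < 1" using dense \<theta>\<^sub>0 by blast
    then have "\<theta> * q \<le> 0" using False \<theta>\<^sub>0 by (intro mult_nonneg_nonpos) auto
    with \<theta> \<open>p > 1\<close> show ?thesis by (intro exI[of _ \<theta>]) auto
  qed
  then obtain \<theta> where \<theta>: "\<theta>\<^sub>0 < \<theta>" "\<theta> < 1" "\<theta> * q < p - 1" by blast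
  define s where "s = (p - 1 - \<theta> * q) / (1 - \<theta>)"
  have "s > 0" using \<theta> by (simp add: s_def)
  moreover have "p - 1 - s = \<theta> * (q - s)"
  proof -
    have "s * (1 - \<theta>) = p - 1 - \<theta> * q" using \<theta> by (simp add: s_def)
    then show ?thesis by (simp add: algebra_simps)
  qed
  moreover have "n < p / (1 - \<theta>)"
  proof -
    have "1 - p / n < \<theta>" using \<theta> \<theta>\<^sub>0 by linarith
    then have "n * (1 - \<theta>) < p" using \<open>n > 0\<close> by (simp add: field_simps)
    then show ?thesis using \<theta> by (simp add: pos_less_divide_eq)
  qed
  ultimately show ?thesis using \<theta> \<theta>\<^sub>0 by (intro exI[of _ \<theta>] exI[of _ s]) auto
qed

text \<open>Young's inequality with an explicit constant. If \<open>m B \<le> s X\<close>, the left-hand side is not positive;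
  otherwise \<open>X\<close> is at most \<open>(m/s) B\<close>.\<close>

lemma absorb_gradient_term:
  fixes X B m s p :: real
  assumes "X \<ge> 0" "B \<ge> 0" "m > 0" "s > 0" "p > 1"
  shows "m * X powr (p - 1) * B - s * X powr p \<le> m * (m / s) powr (p - 1) * B powr p"
proof -
  have rhs: "0 \<le> m * (m / s) powr (p - 1) * B powr p" using assms by simp
  have Xp: "X powr p = X powr (p - 1) * X"
    using powr_mult_base[of X "p - 1"] \<open>X \<ge> 0\<close> by (simp add: mult.commute)
  have Bp: "B powr p = B powr (p - 1) * B"
    using powr_mult_base[of B "p - 1"] \<open>B \<ge> 0\<close> by (simp add: mult.commute)
  show ?thesis
  proof (cases "m * B \<le> s * X")
    case True
    have "m * X powr (p - 1) * B - s * X powr p = X powr (p - 1) * (m * B - s * X)"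
      by (simp add: Xp algebra_simps)
    also have "\<dots> \<le> 0" using True by (intro mult_nonneg_nonpos) auto
    finally show ?thesis using rhs by linarith
  next
    case False
    then have "X \<le> m / s * B" using \<open>s > 0\<close> by (simp add: field_simps)
    then have "X powr (p - 1) \<le> (m / s * B) powr (p - 1)"
      using assms by (intro powr_mono2) auto
    also have "\<dots> = (m / s) powr (p - 1) * B powr (p - 1)"
      using assms by (subst powr_mult) auto
    finally have "m * (X powr (p - 1) * B) \<le> m * ((m / s) powr (p - 1) * B powr (p - 1) * B)"
      using assms by (intro mult_left_mono mult_right_mono) auto
    moreover have "0 \<le> s * X powr p" using assms by simp
    ultimately show ?thesis by (simp add: Bp mult.assoc)
  qed
qed

text \<open>Young's inequality again: either \<open>D\<close> is small against \<open>W\<^sup>1\<^sup>-\<^sup>\<theta>\<close> and the first summand suffices, or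
  \<open>W\<close> is bounded by a power of \<open>D\<close> and the second one does.\<close>

lemma absorb_power:
  fixes W D b \<theta> :: real
  assumes "W > 0" "D \<ge> 0" "b > 0" "0 < \<theta>" "\<theta> < 1"
  shows "W powr \<theta> * D \<le> b * W + b * (D / b) powr (1 / (1 - \<theta>))"
proof (cases "D \<le> b * W powr (1 - \<theta>)")
  case True
  then have "W powr \<theta> * D \<le> W powr \<theta> * (b * W powr (1 - \<theta>))"
    by (intro mult_left_mono) auto
  also have "\<dots> = b * (W powr \<theta> * W powr (1 - \<theta>))" by simp
  also have "\<dots> = b * W" using \<open>W > 0\<close> by (simp add: powr_add[symmetric])
  finally show ?thesis using assms by (simp add: add_increasing2)
next
  case False
  then have "b * W powr (1 - \<theta>) < D" by simp
  then have D: "W powr (1 - \<theta>) < D / b"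
    using \<open>b > 0\<close> by (simp add: pos_less_divide_eq mult.commute)
  then have "D / b > 0" by (rule le_less_trans[OF powr_ge_zero])
  have "W powr \<theta> = (W powr (1 - \<theta>)) powr (\<theta> / (1 - \<theta>))"
    using assms by (simp add: powr_powr)
  also have "\<dots> \<le> (D / b) powr (\<theta> / (1 - \<theta>))"
    using D assms by (intro powr_mono2) auto
  finally have "W powr \<theta> * D \<le> (D / b) powr (\<theta> / (1 - \<theta>)) * D"
    using assms by (intro mult_right_mono) auto
  also have "\<dots> = b * ((D / b) powr (\<theta> / (1 - \<theta>)) * (D / b))"
  proof -
    have "y * D = b * (y * (D / b))" for y using assms by simp
    then show ?thesis .
  qed
  also have "\<dots> = b * (D / b) powr (\<theta> / (1 - \<theta>) + 1)"
    using powr_mult_base[OF less_imp_le[OF \<open>D / b > 0\<close>], of "\<theta> / (1 - \<theta>)"]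
    by (simp only: mult.commute[of "D / b"] add.commute[of 1])
  also have "\<theta> / (1 - \<theta>) + 1 = 1 / (1 - \<theta>)" using assms by (simp add: field_simps)
  finally show ?thesis using assms by (simp add: add_increasing)
qed

text \<open>Here \<open>t\<close> stands for the cutoff, \<open>V\<close> for the solution, \<open>Y\<close> for the norm of its gradient and \<open>Z\<close> for a
  bound of the gradient of the cutoff. In the scale-invariant quantities \<open>X = Y/V\<close> and \<open>B = Z/t\<close> the
  left-hand side is \<open>t\<^sup>m V\<^sup>p\<^sup>-\<^sup>1\<^sup>-\<^sup>s (m X\<^sup>p\<^sup>-\<^sup>1 B - s X\<^sup>p)\<close>, to which the two preceding lemmas apply in turn.
  The exponent \<open>m\<close> must be at least \<open>\<beta>\<close> so that \<open>t\<^sup>m\<close> compensates the singular factor \<open>t\<^sup>-\<^sup>\<beta>\<close> of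
  \<open>B\<^sup>\<beta>\<close>.\<close>

lemma pointwise_estimate:
  fixes t V Y Z a p q s \<theta> :: real and m :: nat
  defines "C \<equiv> real m * (real m / s) powr (p - 1)" and "\<beta> \<equiv> p / (1 - \<theta>)"
  assumes "p > 1" "a > 0" "s > 0" "0 < \<theta>" "\<theta> < 1" and s: "p - 1 - s = \<theta> * (q - s)"
    and m: "\<beta> \<le> real m" "m > 0"
    and t: "0 < t" "t \<le> 1" and V: "V > 0" and "Y \<ge> 0" "Z \<ge> 0"
  shows "real m * t ^ (m - 1) * V powr (- s) * Y powr (p - 1) * Z - s * t ^ m * V powr (- s - 1) * Y powr p
    \<le> a / 2 * (t ^ m * V powr (q - s)) + a / 2 * (2 * C / a) powr (1 / (1 - \<theta>)) * Z powr \<beta>"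
proof -
  define X where "X = Y / V"
  define B where "B = Z / t"
  define W where "W = V powr (q - s)"
  let ?K = "a / 2 * (2 * C / a) powr (1 / (1 - \<theta>))"
  have nonneg: "X \<ge> 0" "B \<ge> 0" "W > 0" "C \<ge> 0" using assms by (auto simp: X_def B_def W_def C_def)
  have Y: "Y = V * X" and Z: "Z = t * B" using V t by (auto simp: X_def B_def)
  have tm: "t ^ m = t ^ (m - 1) * t" using \<open>m > 0\<close> by (cases m) auto
  have "V powr (p - 1 - s) = V powr (- s) * V powr (p - 1)"
    and "V powr (p - 1 - s) = V powr (- s - 1) * V powr p"
    by (simp_all add: powr_add[symmetric] algebra_simps)
  then have VX: "V powr (- s) * Y powr (p - 1) = V powr (p - 1 - s) * X powr (p - 1)"
    and VX': "V powr (- s - 1) * Y powr p = V powr (p - 1 - s) * X powr p"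
    using V nonneg by (simp_all add: Y powr_mult)
  have "real m * t ^ (m - 1) * V powr (- s) * Y powr (p - 1) * Z - s * t ^ m * V powr (- s - 1) * Y powr p
      = t ^ m * (V powr (p - 1 - s) * (real m * X powr (p - 1) * B - s * X powr p))"
  proof -
    have "real m * t ^ (m - 1) * V powr (- s) * Y powr (p - 1) * Z - s * t ^ m * V powr (- s - 1) * Y powr p
        = real m * t ^ (m - 1) * (V powr (- s) * Y powr (p - 1)) * (t * B) - s * (t ^ (m - 1) * t) * (V powr (- s - 1) * Y powr p)"
      by (simp only: tm Z mult_ac)
    also have "\<dots> = t ^ m * (V powr (p - 1 - s) * (real m * X powr (p - 1) * B - s * X powr p))"
      unfolding VX VX' tm by (simp add: algebra_simps)
    finally show ?thesis .
  qed
  also have "\<dots> \<le> t ^ m * (V powr (p - 1 - s) * (C * B powr p))"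
    unfolding C_def using absorb_gradient_term[of X B "real m" s p] nonneg assms
    by (intro mult_left_mono) auto
  also have "V powr (p - 1 - s) = W powr \<theta>"
    by (simp add: W_def powr_powr s mult.commute)
  also have "t ^ m * (W powr \<theta> * (C * B powr p))
      \<le> t ^ m * (a / 2 * W + a / 2 * (C * B powr p / (a / 2)) powr (1 / (1 - \<theta>)))"
    using nonneg assms by (intro mult_left_mono absorb_power) auto
  also have "a / 2 * (C * B powr p / (a / 2)) powr (1 / (1 - \<theta>)) = ?K * B powr \<beta>"
  proof -
    have *: "C * B powr p / (a / 2) = (2 * C / a) * B powr p" by simp
    show ?thesis
      unfolding * using nonneg \<open>a > 0\<close> by (subst powr_mult) (simp_all add: powr_powr \<beta>_def)
  qed
  also have "t ^ m * (a / 2 * W + ?K * B powr \<beta>) = a / 2 * (t ^ m * W) + ?K * (t ^ m * B powr \<beta>)"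
    by (simp add: algebra_simps)
  also have "t ^ m * B powr \<beta> \<le> Z powr \<beta>"
  proof -
    have "t ^ m = t powr real m" using t by (simp add: powr_realpow)
    also have "\<dots> \<le> t powr \<beta>" using t m by (intro powr_mono') auto
    finally have "t ^ m * B powr \<beta> \<le> t powr \<beta> * B powr \<beta>" by (intro mult_right_mono) auto
    also have "\<dots> = Z powr \<beta>" using t nonneg by (simp add: Z powr_mult)
    finally show ?thesis .
  qed
  then have "?K * (t ^ m * B powr \<beta>) \<le> ?K * Z powr \<beta>"
    using \<open>a > 0\<close> by (intro mult_left_mono) auto
  finally show ?thesis by (simp add: W_def)
qed

section \<open>The cutoff function\<close>


lemma DERIV_pos_part_power:
  fixes t :: real
  assumes "m \<ge> 2"
  shows "((\<lambda>t. max 0 t ^ m) has_real_derivative real m * max 0 t ^ (m - 1)) (at t)"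
proof -
  consider "t > 0" | "t < 0" | "t = 0" by linarith
  then show ?thesis
  proof cases
    case 1
    then have "((\<lambda>t. t ^ m) has_real_derivative real m * max 0 t ^ (m - 1)) (at t)"
      by (auto intro!: derivative_eq_intros)
    then show ?thesis
      by (rule has_field_derivative_transform_within_open[where S = "{0<..}"]) (use 1 in auto)
  next
    case 2
    then have "((\<lambda>t. 0) has_real_derivative real m * max 0 t ^ (m - 1)) (at t)"
      using assms by (simp add: max_def power_0_left)
    then show ?thesis
      by (rule has_field_derivative_transform_within_open[where S = "{..<0}"])
         (use 2 assms in \<open>auto simp: max_def power_0_left\<close>)
  next
    case 3
    have "(\<lambda>h. \<bar>h :: real\<bar> ^ (m - 1)) \<midarrow>0\<rightarrow> \<bar>0\<bar> ^ (m - 1)"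
      by (intro tendsto_intros)
    then have lim: "(\<lambda>h. \<bar>h :: real\<bar> ^ (m - 1)) \<midarrow>0\<rightarrow> 0" using assms by (simp add: power_0_left)
    have "(\<lambda>h. max 0 h ^ m / h) \<midarrow>0\<rightarrow> (0 :: real)"
    proof (rule Lim_null_comparison[OF _ lim])
      have "norm (max 0 h ^ m / h) \<le> \<bar>h\<bar> ^ (m - 1)" if "h \<noteq> 0" for h :: real
        using that assms by (cases m) (auto simp: max_def)
      then show "\<forall>\<^sub>F h in at 0. norm (max 0 h ^ m / h :: real) \<le> \<bar>h\<bar> ^ (m - 1)"
        by (auto simp: eventually_at_filter)
    qed
    then show ?thesis
      using 3 assms by (simp add: DERIV_def power_0_left)
  qed
qed

text \<open>The positive part makes this a compactly supported cutoff; it is merely Lipschitz, but its powers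
  with exponent at least \<open>2\<close> are \<open>C\<^sup>1\<close>.\<close>

definition paraboloid :: "real \<Rightarrow> real^'n \<Rightarrow> real" where
  "paraboloid R x = max 0 (1 - x \<bullet> x / R\<^sup>2)"

lemma paraboloid_bounds: "0 \<le> paraboloid R x" "paraboloid R x \<le> 1"
  by (auto simp: paraboloid_def)

lemma paraboloid_support:
  assumes "R > 0" "paraboloid R x \<noteq> 0"
  shows "norm x \<le> R" and "x \<in> cube R"
proof -
  have "x \<bullet> x < R\<^sup>2" using assms by (auto simp: paraboloid_def max_def field_simps split: if_splits)
  then show *: "norm x \<le> R" using \<open>R > 0\<close> power2_less_imp_less[of "norm x" R] by (simp add: power2_norm_eq_inner less_imp_le)
  then show "x \<in> cube R" using component_le_norm_cart[of x] by (auto simp: mem_cube intro: order_trans)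
qed

lemma continuous_on_paraboloid: "continuous_on S (paraboloid R)"
  unfolding paraboloid_def by (cases "R = 0") (auto intro!: continuous_intros)

lemma GDERIV_paraboloid_power:
  assumes "m \<ge> 2"
  shows "GDERIV (\<lambda>x. paraboloid R x ^ m) x :> (real m * paraboloid R x ^ (m - 1)) *\<^sub>R ((- 2 / R\<^sup>2) *\<^sub>R x)"
proof -
  have "GDERIV (\<lambda>x. 1 - x \<bullet> x / R\<^sup>2) x :> (- 2 / R\<^sup>2) *\<^sub>R x"
    unfolding gderiv_def divide_inverse
    by (rule derivative_eq_intros refl | simp add: inner_commute algebra_simps)+
  from GDERIV_DERIV_compose[OF this DERIV_pos_part_power[OF assms]] show ?thesis
    by (simp add: paraboloid_def)
qed

lemma measure_cube:
  assumes "R \<ge> 0"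
  shows "measure lebesgue (cube R :: (real^'n) set) = (2 * R) ^ CARD('n)"
proof -
  have "(0 :: real^'n) \<in> cube R" using assms by (simp add: mem_cube)
  then have "(cbox (\<chi> i. - R) (\<chi> i. R) :: (real^'n) set) \<noteq> {}" unfolding cube_def by blast
  then show ?thesis unfolding cube_def by (simp add: content_cbox_cart)
qed

text \<open>The cutoffs increase with \<open>R\<close>, so the value at \<open>R = 1\<close> is a lower bound.\<close>

lemma integral_paraboloid_lower_bound:
  fixes w :: "real^'n \<Rightarrow> real"
  assumes w: "continuous_on UNIV w" and pos: "\<And>x. w x > 0" and "m > 0"
  shows "\<exists>c>0. \<forall>R\<ge>1. c \<le> (\<integral>x. paraboloid R x ^ m * w x \<partial>lebesgue)"
proof (intro exI conjI allI impI)
  let ?J = "\<lambda>R x. paraboloid R x ^ m * w x"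
  have cont: "continuous_on S (?J R)" for R S
    using continuous_on_subset[OF w] by (auto intro!: continuous_intros continuous_on_paraboloid)
  have supp: "?J R x = 0" if "R > 0" "x \<notin> cube R" for R x
    using paraboloid_support(2)[OF that(1)] that \<open>m > 0\<close> by (auto simp: zero_power)
  have nonneg: "?J R x \<ge> 0" for R x
    using paraboloid_bounds(1)[of R x] pos[of x] by (simp add: less_imp_le)
  show "integral (cube 1) (?J 1) > 0"
  proof -
    have "\<exists>x\<in>cube 1. ?J 1 x \<noteq> 0"
      using pos[of 0] by (intro bexI[of _ 0]) (auto simp: paraboloid_def mem_cube)
    then have "integral (cube 1) (?J 1) \<noteq> 0"
      unfolding cube_def
      by (subst integral_cbox_eq_0_iff)
         (use cont nonneg in \<open>auto simp: interval_ne_empty_cart\<close>)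
    moreover have "integral (cube 1) (?J 1) \<ge> 0"
      by (intro integral_nonneg nonneg) (simp add: cube_def integrable_continuous cont)
    ultimately show ?thesis by linarith
  qed
  fix R :: real assume "R \<ge> 1"
  have "integral (cube 1) (?J 1) = (\<integral>x. ?J 1 x \<partial>lebesgue)"
    using cont supp by (intro integral_compact_support(2)[symmetric]) auto
  also have "\<dots> \<le> (\<integral>x. ?J R x \<partial>lebesgue)"
  proof (rule Bochner_Integration.integral_mono')
    show "integrable lebesgue (?J R)"
      by (rule integrable_compact_support[OF cont supp[of R]]) (use \<open>R \<ge> 1\<close> in auto)
    fix x :: "real^'n"
    have "x \<bullet> x / R\<^sup>2 \<le> x \<bullet> x / 1"
      using \<open>R \<ge> 1\<close> by (intro divide_left_mono) (auto simp: one_le_power)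
    then have "paraboloid 1 x \<le> paraboloid R x" by (simp add: paraboloid_def)
    then show "?J 1 x \<le> ?J R x"
      using pos[of x] paraboloid_bounds(1) by (intro mult_right_mono power_mono) (auto simp: less_imp_le)
  qed (rule nonneg)
  finally show "integral (cube 1) (?J 1) \<le> (\<integral>x. ?J R x \<partial>lebesgue)" .
qed

section \<open>Nonexistence of positive solutions\<close>


lemma has_C1_gradient_test_function:
  fixes v :: "real^'n \<Rightarrow> real"
  assumes v: "has_C1_gradient v (grad v)" and pos: "\<And>x. v x > 0" and m: "m \<ge> 2"
  shows "has_C1_gradient (\<lambda>x. paraboloid R x ^ m * v x powr (- s))
    (\<lambda>x. (real m * paraboloid R x ^ (m - 1) * v x powr (- s)) *\<^sub>R ((- 2 / R\<^sup>2) *\<^sub>R x)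
      - (s * paraboloid R x ^ m * v x powr (- s - 1)) *\<^sub>R grad v x)"
  unfolding has_C1_gradient_def
proof (intro conjI allI)
  have vc: "continuous_on UNIV v" "continuous_on UNIV (grad v)"
    using has_C1_gradient_continuous[OF v] has_C1_gradient_continuous_gradient[OF v] .
  have nz: "v x \<noteq> 0" for x using pos[of x] by simp
  show "continuous_on UNIV (\<lambda>x. (real m * paraboloid R x ^ (m - 1) * v x powr (- s)) *\<^sub>R ((- 2 / R\<^sup>2) *\<^sub>R x)
      - (s * paraboloid R x ^ m * v x powr (- s - 1)) *\<^sub>R grad v x)"
    using vc nz by (intro continuous_intros continuous_on_paraboloid) auto
  fix x
  have "GDERIV v x :> grad v x" using v by (simp add: has_C1_gradient_def)
  moreover have "DERIV (\<lambda>y. y powr (- s)) (v x) :> - s * v x powr (- s - 1)"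
    using has_real_derivative_powr[OF pos[of x], of "- s"] by simp
  ultimately have "GDERIV (\<lambda>x. v x powr (- s)) x :> (- s * v x powr (- s - 1)) *\<^sub>R grad v x"
    by (rule GDERIV_DERIV_compose)
  from GDERIV_mult[OF GDERIV_paraboloid_power[OF m] this, of R]
  show "GDERIV (\<lambda>x. paraboloid R x ^ m * v x powr (- s)) x :>
      (real m * paraboloid R x ^ (m - 1) * v x powr (- s)) *\<^sub>R ((- 2 / R\<^sup>2) *\<^sub>R x)
      - (s * paraboloid R x ^ m * v x powr (- s - 1)) *\<^sub>R grad v x"
    by (rule GDERIV_subst) (simp add: algebra_simps)
qed

text \<open>The integrand on the gradient side of the weak equation is bounded pointwise by half of the
  integrand of the other side plus a constant multiple of \<open>R\<^sup>-\<^sup>\<beta>\<close> on the cube of side \<open>2R\<close>, which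
  contains the support of the cutoff; the half is then moved to the left.\<close>

lemma energy_estimate:
  fixes v :: "real^'n \<Rightarrow> real" and m :: nat
  assumes sol: "positive_solution p a q v"
    and "p > 1" "a > 0" "s > 0" "0 < \<theta>" "\<theta> < 1" and s: "p - 1 - s = \<theta> * (q - s)"
    and m: "p / (1 - \<theta>) \<le> real m" "m \<ge> 2"
  shows "\<exists>C. \<forall>R>0. (\<integral>x. paraboloid R x ^ m * v x powr (q - s) \<partial>lebesgue)
    \<le> C * R powr (real CARD('n) - p / (1 - \<theta>))"
proof -
  let ?\<phi> = paraboloid
  define \<beta> where "\<beta> = p / (1 - \<theta>)"
  define K where "K = a / 2 * (2 * (real m * (real m / s) powr (p - 1)) / a) powr (1 / (1 - \<theta>))"
  have pos: "v x > 0" for x using sol by (simp add: positive_solution_def)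
  have v: "has_C1_gradient v (grad v)"
    using sol by (intro Ck_on_1_gradient) (simp add: positive_solution_def)
  have vc: "continuous_on UNIV v" using has_C1_gradient_continuous[OF v] .
  have "\<beta> > 0" "K \<ge> 0" using assms by (auto simp: \<beta>_def K_def)
  have bound: "(\<integral>x. ?\<phi> R x ^ m * v x powr (q - s) \<partial>lebesgue)
      \<le> (2 * K * 2 powr \<beta> * 2 ^ CARD('n) / a) * R powr (real CARD('n) - \<beta>)" if "R > 0" for R
  proof -
    let ?\<psi> = "\<lambda>x. ?\<phi> R x ^ m * v x powr (- s)"
    let ?g = "\<lambda>x. (real m * ?\<phi> R x ^ (m - 1) * v x powr (- s)) *\<^sub>R ((- 2 / R\<^sup>2) *\<^sub>R x)
      - (s * ?\<phi> R x ^ m * v x powr (- s - 1)) *\<^sub>R grad v x"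
    let ?J = "\<lambda>x. ?\<phi> R x ^ m * v x powr (q - s)"
    let ?G = "\<lambda>x. a / 2 * ?J x + K * (2 / R) powr \<beta> * indicator (cube R) x"
    have \<phi>0: "?\<phi> R x ^ k = 0" if "x \<notin> cube R" "k > 0" for x k
      using paraboloid_support(2)[OF \<open>R > 0\<close>] that by (auto simp: zero_power)
    have J: "integrable lebesgue ?J"
    proof (rule integrable_compact_support)
      show "continuous_on UNIV ?J"
        using vc pos by (intro continuous_intros continuous_on_paraboloid) (auto simp: less_imp_neq[symmetric])
      show "?J x = 0" if "x \<notin> cube R" for x using \<phi>0[OF that, of m] m by simp
    qed
    have cubeR: "integrable lebesgue (indicator (cube R) :: real^'n \<Rightarrow> real)"
      by (rule integrable_real_indicator) (simp_all add: cube_def emeasure_lborel_cbox_eq)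
    have "W1p_zero p ?\<psi> ?g"
      by (rule W1p_zero_C1_compact_support[OF has_C1_gradient_test_function[OF v pos]])
         (use \<phi>0 m \<open>p > 1\<close> in auto)
    moreover have "ess_compact_support ?\<psi>"
      unfolding ess_compact_support_def
      by (intro exI[of _ "cube R"] conjI AE_I2) (use \<phi>0 m in \<open>auto simp: cube_def\<close>)
    ultimately have eq: "(\<integral>x. norm (grad v x) powr (p - 2) * (grad v x \<bullet> ?g x) \<partial>lebesgue)
        = (\<integral>x. a * v x powr q * ?\<psi> x \<partial>lebesgue)"
      using sol unfolding positive_solution_def weak_solution_def by blast
    have "a * (\<integral>x. ?J x \<partial>lebesgue) = (\<integral>x. a * v x powr q * ?\<psi> x \<partial>lebesgue)"
      unfolding integral_mult_right_zero[symmetric]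
      by (intro Bochner_Integration.integral_cong refl) (simp add: powr_diff powr_minus field_simps)
    also have "\<dots> \<le> (\<integral>x. ?G x \<partial>lebesgue)"
      unfolding eq[symmetric]
    \<comment> \<open>The Bochner integral of a non-integrable function is \<open>0\<close>, so domination by the nonnegative
      integrable \<open>?G\<close> implies the inequality between the integrals in every case.\<close>
    proof (rule Bochner_Integration.integral_mono')
      show "integrable lebesgue ?G" using J cubeR by simp
      fix x :: "real^'n"
      have Jx: "?J x \<ge> 0" using paraboloid_bounds(1)[of R x] by simp
      then show Gx: "0 \<le> ?G x" using \<open>a > 0\<close> \<open>K \<ge> 0\<close> by simp
      show "norm (grad v x) powr (p - 2) * (grad v x \<bullet> ?g x) \<le> ?G x"
      proof (cases "?\<phi> R x = 0")
        case True
        then have "?g x = 0" using m by (simp add: zero_power)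
        then show ?thesis using Gx by (simp only: inner_zero_right mult_zero_right)
      next
        case False
        define t where "t = ?\<phi> R x"
        define Y where "Y = norm (grad v x)"
        define Z where "Z = 2 / R"
        have t: "0 < t" "t \<le> 1" using False paraboloid_bounds[of R x] by (auto simp: t_def)
        have x: "norm x \<le> R" "x \<in> cube R" using paraboloid_support[OF \<open>R > 0\<close> False] .
        have Y1: "Y powr (p - 2) * Y = Y powr (p - 1)" and Y2: "Y powr (p - 2) * Y\<^sup>2 = Y powr p"
          using powr_mult_base[of Y "p - 2"] powr_mult_base[of Y "p - 1"]
          by (simp_all add: Y_def mult.commute power2_eq_square mult.left_commute mult.assoc)
        have "grad v x \<bullet> ((- 2 / R\<^sup>2) *\<^sub>R x) \<le> Y * norm ((- 2 / R\<^sup>2) *\<^sub>R x)"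
          unfolding Y_def by (rule norm_cauchy_schwarz)
        also have "norm ((- 2 / R\<^sup>2) *\<^sub>R x) \<le> Z"
          using x \<open>R > 0\<close> by (simp add: Z_def field_simps power2_eq_square)
        finally have inner: "grad v x \<bullet> ((- 2 / R\<^sup>2) *\<^sub>R x) \<le> Y * Z"
          by (simp add: Y_def mult_left_mono)
        have "norm (grad v x) powr (p - 2) * (grad v x \<bullet> ?g x)
          = real m * t ^ (m - 1) * v x powr (- s) * Y powr (p - 2) * (grad v x \<bullet> ((- 2 / R\<^sup>2) *\<^sub>R x))
            - s * t ^ m * v x powr (- s - 1) * (Y powr (p - 2) * Y\<^sup>2)"
          by (simp add: inner_diff_right t_def Y_def power2_norm_eq_inner algebra_simps)
        also have "\<dots> \<le> real m * t ^ (m - 1) * v x powr (- s) * Y powr (p - 2) * (Y * Z)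
            - s * t ^ m * v x powr (- s - 1) * (Y powr (p - 2) * Y\<^sup>2)"
          using inner t by (intro diff_right_mono mult_left_mono) auto
        also have "\<dots> = real m * t ^ (m - 1) * v x powr (- s) * Y powr (p - 1) * Z
            - s * t ^ m * v x powr (- s - 1) * Y powr p"
          unfolding Y2 by (simp only: Y1[symmetric] mult_ac)
        also have "\<dots> \<le> a / 2 * (t ^ m * v x powr (q - s)) + K * Z powr \<beta>"
          unfolding K_def \<beta>_def
          by (rule pointwise_estimate) (use assms t pos \<open>R > 0\<close> in \<open>auto simp: Y_def Z_def\<close>)
        also have "\<dots> = ?G x" using x by (simp add: t_def Z_def)
        finally show ?thesis .
      qed
    qed
    also have "\<dots> = a / 2 * (\<integral>x. ?J x \<partial>lebesgue) + K * (2 / R) powr \<beta> * (2 * R) ^ CARD('n)"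
      using J cubeR measure_cube[of R, where 'n = 'n] \<open>R > 0\<close> by simp
    finally have "(\<integral>x. ?J x \<partial>lebesgue) \<le> 2 * K / a * ((2 / R) powr \<beta> * (2 * R) ^ CARD('n))"
      using \<open>a > 0\<close> by (simp add: field_simps)
    also have "(2 / R) powr \<beta> * (2 * R) ^ CARD('n) = 2 powr \<beta> * 2 ^ CARD('n) * R powr (real CARD('n) - \<beta>)"
      using \<open>R > 0\<close> by (simp add: powr_divide powr_diff powr_realpow power_mult_distrib)
    finally show ?thesis by (simp add: mult_ac)
  qed
  then show ?thesis unfolding \<beta>_def by blast
qed

proposition no_positive_solution:
  fixes p a q :: real
  assumes "p > 1" "a > 0" and q: "q * (real CARD('n) - p) < real CARD('n) * (p - 1)"
  shows "\<not> positive_solution p a q (v :: real^'n \<Rightarrow> real)"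
proof
  assume sol: "positive_solution p a q v"
  obtain \<theta> s where \<theta>: "0 < \<theta>" "\<theta> < 1" and s: "s > 0" "p - 1 - s = \<theta> * (q - s)"
    and n: "real CARD('n) < p / (1 - \<theta>)"
    using exists_exponents[OF \<open>p > 1\<close> _ q] by auto
  \<comment> \<open>\<open>m \<ge> p / (1 - \<theta>)\<close> is what the pointwise estimate needs, \<open>m \<ge> 2\<close> makes the test function \<open>C\<^sup>1\<close>.\<close>
  define m where "m = nat \<lceil>p / (1 - \<theta>)\<rceil> + 2"
  have m: "p / (1 - \<theta>) \<le> real m" "m \<ge> 2" unfolding m_def by linarith+
  obtain C where C: "\<And>R. R > 0 \<Longrightarrow> (\<integral>x. paraboloid R x ^ m * v x powr (q - s) \<partial>lebesgue)
      \<le> C * R powr (real CARD('n) - p / (1 - \<theta>))"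
    using energy_estimate[OF sol \<open>p > 1\<close> \<open>a > 0\<close> s(1) \<theta> s(2) m] by blast
  have pos: "v x > 0" for x using sol by (simp add: positive_solution_def)
  have "has_C1_gradient v (grad v)"
    using sol by (intro Ck_on_1_gradient) (simp add: positive_solution_def)
  then have vc: "continuous_on UNIV v" by (rule has_C1_gradient_continuous)
  have "continuous_on UNIV (\<lambda>x. v x powr (q - s))"
    using vc pos by (intro continuous_intros) (auto simp: less_imp_neq[symmetric])
  moreover have "v x powr (q - s) > 0" for x using pos[of x] by simp
  ultimately obtain c where c: "c > 0"
    and "\<And>R. R \<ge> 1 \<Longrightarrow> c \<le> (\<integral>x. paraboloid R x ^ m * v x powr (q - s) \<partial>lebesgue)"
    using integral_paraboloid_lower_bound[of "\<lambda>x. v x powr (q - s)" m] m by auto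
  with C have c_le: "c \<le> C * R powr (real CARD('n) - p / (1 - \<theta>))" if "1 \<le> R" for R
    using that by (meson order_trans less_le_trans zero_less_one)
  have lim: "((\<lambda>R. C * R powr (real CARD('n) - p / (1 - \<theta>))) \<longlongrightarrow> C * 0) at_top"
    using n by (intro tendsto_mult tendsto_const tendsto_neg_powr filterlim_ident) auto
  have "c \<le> C * 0"
    by (rule tendsto_lowerbound[OF lim eventually_mono[OF eventually_ge_at_top c_le]]) simp_all
  with c show False by simp
qed

theorem theorem1p9:
  fixes p a q :: real
  assumes n: "CARD('n::finite) \<ge> 3"
    and p: "p > 1"
    and cases:
      "(a > 0 \<and> 1 < p \<and> p < real CARD('n) \<and> p \<noteq> q \<and>
          q \<in> {p - 1 <..< (p - 1) * real CARD('n) / (real CARD('n) - p)})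
       \<or> (a > 0 \<and> p \<ge> real CARD('n) \<and> p \<noteq> q \<and> q \<in> {0<..})
       \<or> (a \<ge> 1 \<and> 1 < p \<and> p = q \<and> q < real CARD('n) \<and> real CARD('n) < p^2)
       \<or> (a \<ge> 1 \<and> p = q \<and> q \<ge> real CARD('n))"
  shows "\<not> (\<exists>v :: real^'n \<Rightarrow> real. positive_solution p a q v)"
proof -
  have "a > 0" using cases by auto
  have large: "q * (real CARD('n) - p) < real CARD('n) * (p - 1)" if "q > 0" "p \<ge> real CARD('n)"
  proof -
    have "q * (real CARD('n) - p) \<le> 0" using that by (intro mult_nonneg_nonpos) auto
    also have "0 < real CARD('n) * (p - 1)" using p n by simp
    finally show ?thesis .
  qed
  have "q * (real CARD('n) - p) < real CARD('n) * (p - 1)"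
    using cases
  proof (elim disjE conjE)
    assume "p < real CARD('n)" "q \<in> {p - 1 <..< (p - 1) * real CARD('n) / (real CARD('n) - p)}"
    then show ?thesis by (simp add: pos_less_divide_eq mult.commute)
  next
    assume "p = q" "real CARD('n) < p^2"
    then show ?thesis by (simp add: algebra_simps power2_eq_square)
  qed (use large p in auto)
  then show ?thesis using no_positive_solution[OF p \<open>a > 0\<close>] by blast
qed

end
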